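(* Let $k>1$ be a fixed integer, $\nu$ a fixed positive integer and $\varepsilon>0$ a fixed real number. Then for sufficiently large real $Q\ge1$, for all but $O(Q^{1-\varepsilon})$ integers $q\in[Q,2Q]$ the following holds: for every sequence of complex weights $\mathcal{A}=\{\alpha_m\}_{m\in\mathbb{Z}_q}$ and every set $\mathcal{J}=\{L+1,\ldots,L+N\}\subseteq\mathbb{Z}_q$ of $N$ consecutive residues modulo $q$, $$\mathcal{S}^*_{k,q}(\mathcal{A};\mathcal{J})\ll\|\mathcal{A}\|_1^{1-1/\nu}\|\mathcal{A}\|_2^{1/\nu}\big(q+q^{(\nu+1)/(2\nu)}N^{1/2}\big)q^{\varepsilon},$$ where $$\mathcal{S}^*_{k,q}(\mathcal{A};\mathcal{J})=\sum_{m\in\mathbb{Z}_q}\sum_{n\in\mathcal{J}}\alpha_m\sum_{x\in\mathbb{Z}_q^*}\exp\!\Big(\frac{2\pi i(mx^k+nx^{-1})}{q}\Big).$$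
   Context: $\mathbb{Z}_q$ is the residue ring modulo $q$, $\mathbb{Z}_q^*$ its unit group, and $x^{-1}$ the inverse of $x$ modulo $q$. $\|\mathcal{A}\|_1=\sum_m|\alpha_m|$, $\|\mathcal{A}\|_2=(\sum_m|\alpha_m|^2)^{1/2}$. $A\ll B$ means $|A|\le cB$ with $c>0$ depending only on $k,\nu,\varepsilon$; the constant in $O(Q^{1-\varepsilon})$ likewise depends only on $k,\nu,\varepsilon$. *)

theory Defs
  imports "HOL-Analysis.Analysis" "HOL-Number_Theory.Number_Theory"
begin

text \<open>
  The residue ring modulo \<open>q\<close> is represented by the integers \<open>{0..<q}\<close>, and a sequence of
  weights indexed by it by a function \<open>int \<Rightarrow> complex\<close> of which only the values on \<open>{0..<q}\<close> matter.
\<close>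

definition residue_units :: "int \<Rightarrow> int set" where
  "residue_units q = {x \<in> {0..<q}. coprime x q}"

definition residue_interval :: "int \<Rightarrow> int \<Rightarrow> nat \<Rightarrow> int set" where
  "residue_interval q L N = (\<lambda>j. j mod q) ` {L + 1..L + int N}"

definition weights_norm1 :: "int \<Rightarrow> (int \<Rightarrow> complex) \<Rightarrow> real" where
  "weights_norm1 q \<alpha> = (\<Sum>m\<in>{0..<q}. cmod (\<alpha> m))"

definition weights_norm2 :: "int \<Rightarrow> (int \<Rightarrow> complex) \<Rightarrow> real" where
  "weights_norm2 q \<alpha> = sqrt (\<Sum>m\<in>{0..<q}. (cmod (\<alpha> m))\<^sup>2)"

definition kloosterman_form :: "nat \<Rightarrow> int \<Rightarrow> (int \<Rightarrow> complex) \<Rightarrow> int set \<Rightarrow> complex" where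
  "kloosterman_form k q \<alpha> J =
     (\<Sum>m\<in>{0..<q}. \<Sum>n\<in>J. \<alpha> m *
        (\<Sum>x\<in>residue_units q.
           exp (2 * complex_of_real pi * \<i> * of_int (m * x ^ k + n * modular_inverse q x) / of_int q)))"

end

theory Submission
  imports Defs "HOL-Library.Discrete_Functions"
begin

text \<open>
  Substituting \<open>x\<close> by its inverse turns the sum over \<open>n\<close> into a geometric sum of size at most
  \<open>min N (q / \<bar>x\<bar>)\<close>, where \<open>\<bar>x\<bar> \<le> q / 2\<close> is the absolutely least residue. On each dyadic block
  \<open>\<bar>x\<bar> \<le> X\<close>, Hoelder's inequality and orthogonality of additive characters bound the form by the
  number of solutions of
  \<open>x\<^sub>1\<^bsup>-k\<^esup> + \<dots> + x\<^sub>\<nu>\<^bsup>-k\<^esup> \<equiv> y\<^sub>1\<^bsup>-k\<^esup> + \<dots> + y\<^sub>\<nu>\<^bsup>-k\<^esup> (mod q)\<close> with variables in \<open>{1..X}\<close>.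
  Averaged over \<open>q\<close>, tuples for which the equation fails over the rationals contribute
  \<open>X\<^bsup>2\<nu>+o(1)\<^esup>\<close>, because \<open>q\<close> divides a nonzero integer of polynomial size. If the equation holds over
  the rationals, no prime can divide the product of all \<open>2\<nu>\<close> variables exactly once, so this product
  is powerful, and there are only \<open>X\<^bsup>\<nu>+o(1)\<^esup>\<close> such tuples. Markov's inequality then excludes few moduli.
\<close>

section \<open>The divisor bound\<close>

lemma prime_power_decomposition:
  fixes n p :: nat
  assumes "n > 0" "prime p"
  obtains m where "n = p ^ multiplicity p n * m" "\<not> p dvd m"
  by (rule multiplicity_decompose'[of n p]) (use assms that in auto)

text \<open>A divisor of a product splits into a divisor of each factor, so multiplication maps the
  pairs of divisors onto the divisors of \<open>m * n\<close>.\<close>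

lemma card_divisors_mult_le:
  fixes m n :: nat
  assumes "m > 0" "n > 0"
  shows "card {d. d dvd m * n} \<le> card {d. d dvd m} * card {d. d dvd n}"
proof -
  have "{d. d dvd m * n} \<subseteq> (\<lambda>(a, b). a * b) ` ({d. d dvd m} \<times> {d. d dvd n})"
  proof
    fix d assume "d \<in> {d. d dvd m * n}"
    then obtain a b where "d = a * b" "a dvd m" "b dvd n"
      using division_decomp[of d m n] by blast
    then show "d \<in> (\<lambda>(a, b). a * b) ` ({d. d dvd m} \<times> {d. d dvd n})"
      by (intro image_eqI[of _ _ "(a, b)"]) auto
  qed
  then have "card {d. d dvd m * n} \<le> card ({d. d dvd m} \<times> {d. d dvd n})"
    using assms by (intro surj_card_le) auto
  then show ?thesis by (simp add: card_cartesian_product)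
qed

lemma card_divisors_prime_power:
  fixes p :: nat
  assumes "prime p"
  shows "card {d. d dvd p ^ e} = e + 1"
proof -
  have "{d. d dvd p ^ e} = (\<lambda>i. p ^ i) ` {..e}"
    using divides_primepow_nat[OF assms, of _ e] by auto
  moreover have "inj_on (\<lambda>i. p ^ i) {..e}"
    using prime_gt_1_nat[OF assms] by (auto simp: inj_on_def)
  ultimately show ?thesis by (simp add: card_image)
qed

text \<open>Bernoulli's inequality. In the divisor bound, \<open>e + 1\<close> counts the divisors
  of a prime power, and \<open>1 + u\<close> is \<open>2 powr \<delta>\<close> at the small primes
  and 2 at the large ones.\<close>

lemma Suc_le_const_mult_power:
  fixes u :: real
  assumes "u > 0"
  shows "real e + 1 \<le> max 1 (1 / u) * (1 + u) ^ e"
proof -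
  have "real e + 1 \<le> max 1 (1 / u) * 1 + max 1 (1 / u) * u * real e"
  proof -
    have "1 \<le> max 1 (1 / u) * u"
      using assms by (simp add: max_def field_simps)
    then have "1 * real e \<le> max 1 (1 / u) * u * real e"
      by (intro mult_right_mono) auto
    then show ?thesis by simp
  qed
  also have "\<dots> = max 1 (1 / u) * (1 + real e * u)"
    by (simp add: algebra_simps)
  also have "\<dots> \<le> max 1 (1 / u) * (1 + u) ^ e"
    using Bernoulli_inequality[of u e] assms by (intro mult_left_mono) auto
  finally show ?thesis .
qed

text \<open>A factor \<open>p ^ e\<close> with \<open>p \<ge> B\<close> costs nothing, since
  \<open>p powr \<delta> \<ge> 2\<close> gives
  \<open>e + 1 \<le> 2 ^ e \<le> (p powr \<delta>) ^ e\<close>. Each prime below \<open>B\<close>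
  costs a factor \<open>K\<close>, and there are at most \<open>B\<close> of them.\<close>

lemma divisor_bound:
  fixes \<delta> :: real
  assumes "\<delta> > 0"
  obtains C where "C \<ge> 1" "\<And>n::nat. n > 0 \<Longrightarrow> real (card {d. d dvd n}) \<le> C * real n powr \<delta>"
proof -
  obtain B :: nat where B: "real B > 2 powr (1 / \<delta>)"
    using reals_Archimedean2 by blast
  define u where "u = 2 powr \<delta> - 1"
  have u: "u > 0" using assms by (simp add: u_def)
  define K where "K = max 1 (1 / u)"
  have K: "K \<ge> 1" by (simp add: K_def)
  define small where "small n = {p. prime p \<and> p dvd n \<and> p < B}" for n :: nat
  have fin: "finite (small n)" for n
    by (rule finite_subset[of _ "{..<B}"]) (auto simp: small_def)
  \<comment> \<open>With the exponent counting just the small primes that divide \<open>n\<close>,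
    the induction can strip one full prime power at a time and pay \<open>K\<close> once per small
    prime.\<close>
  have main: "real (card {d. d dvd n}) \<le> K ^ card (small n) * real n powr \<delta>" if "n > 0" for n :: nat
    using that
  proof (induction n rule: less_induct)
    case (less n)
    show ?case
    proof (cases "n = 1")
      case True
      then show ?thesis using K by simp
    next
      case False
      then obtain p where p: "prime p" "p dvd n"
        using prime_factor_nat by blast
      define e where "e = multiplicity p n"
      obtain m where m: "n = p ^ e * m" "\<not> p dvd m"
        unfolding e_def using less.prems(1) p(1) by (elim prime_power_decomposition)
      have e: "e > 0" using m p by (cases e) auto
      have m0: "m > 0" using m less.prems by (cases m) auto
      have mn: "m < n"
        using m m0 one_less_power[OF prime_gt_1_nat[OF p(1)], of e] e by auto
      have p1: "p \<ge> 2" using p prime_ge_2_nat by blast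
      have pe: "real (p ^ e) powr \<delta> = (real p powr \<delta>) ^ e"
      proof -
        have "real (p ^ e) powr \<delta> = (real p powr real e) powr \<delta>"
          using p1 by (simp only: of_nat_power powr_realpow)
        also have "\<dots> = (real p powr \<delta>) powr real e"
          by (simp only: powr_powr mult.commute)
        finally show ?thesis
          using p1 by (simp only: powr_realpow powr_gt_zero)
      qed
      have npow: "real n powr \<delta> = (real p powr \<delta>) ^ e * real m powr \<delta>"
        using powr_mult[of "real (p ^ e)" "real m" \<delta>] by (simp only: m(1) of_nat_mult pe)
      have "card {d. d dvd n} \<le> card {d. d dvd p ^ e} * card {d. d dvd m}"
        unfolding m(1) using p1 m0 by (intro card_divisors_mult_le) auto
      then have "real (card {d. d dvd n}) \<le> real ((e + 1) * card {d. d dvd m})"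
        unfolding card_divisors_prime_power[OF p(1)] by (rule of_nat_mono)
      then have "real (card {d. d dvd n}) \<le> (real e + 1) * real (card {d. d dvd m})"
        by (simp only: of_nat_mult of_nat_add of_nat_1)
      also have "\<dots> \<le> (real e + 1) * (K ^ card (small m) * real m powr \<delta>)"
        using less.IH[OF mn m0] by (intro mult_left_mono) auto
      also have "\<dots> \<le> K ^ card (small n) * real n powr \<delta>"
      proof (cases "p < B")
        case True
        have "small n = insert p (small m)"
          using m p True e by (auto simp: small_def prime_dvd_mult_iff prime_dvd_power_iff primes_dvd_imp_eq)
        moreover have "p \<notin> small m" using m by (simp add: small_def)
        ultimately have c: "card (small n) = Suc (card (small m))"
          using fin by simp
        have "real e + 1 \<le> K * (1 + u) ^ e"
          unfolding K_def by (rule Suc_le_const_mult_power[OF u])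
        also have "\<dots> \<le> K * (real p powr \<delta>) ^ e"
          using K p1 assms by (intro mult_left_mono power_mono) (auto simp: u_def intro!: powr_mono2)
        finally have "(real e + 1) * (K ^ card (small m) * real m powr \<delta>) \<le>
            (K * (real p powr \<delta>) ^ e) * (K ^ card (small m) * real m powr \<delta>)"
          using K by (intro mult_right_mono) auto
        also have "\<dots> = K ^ card (small n) * real n powr \<delta>"
          unfolding c npow by simp
        finally show ?thesis .
      next
        case False
        have "small m \<subseteq> small n" using m by (auto simp: small_def)
        then have c: "card (small m) \<le> card (small n)" using fin card_mono by blast
        have "2 \<le> real p powr \<delta>"
        proof -
          have "2 = (2 powr (1 / \<delta>)) powr \<delta>" using assms by (simp add: powr_powr)
          also have "\<dots> \<le> real p powr \<delta>" using False B assms by (intro powr_mono2) auto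
          finally show ?thesis .
        qed
        then have "2 ^ e \<le> (real p powr \<delta>) ^ e" by (intro power_mono) auto
        moreover have "real e + 1 \<le> 2 ^ e"
          using Suc_le_const_mult_power[of 1 e] by simp
        ultimately have "real e + 1 \<le> (real p powr \<delta>) ^ e" by linarith
        then have "(real e + 1) * (K ^ card (small m) * real m powr \<delta>) \<le>
            (real p powr \<delta>) ^ e * (K ^ card (small n) * real m powr \<delta>)"
          using K c by (intro mult_mono power_increasing) auto
        also have "\<dots> = K ^ card (small n) * real n powr \<delta>"
          unfolding npow by simp
        finally show ?thesis .
      qed
      finally show ?thesis .
    qed
  qed
  show ?thesis
  proof (rule that[of "K ^ B"])
    show "K ^ B \<ge> 1" using K by simp
    fix n :: nat assume n: "n > 0"
    have "card (small n) \<le> card {..<B}"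
      by (intro card_mono) (auto simp: small_def)
    then have "K ^ card (small n) \<le> K ^ B" using K by (intro power_increasing) auto
    then show "real (card {d. d dvd n}) \<le> K ^ B * real n powr \<delta>"
      using main[OF n] by (meson mult_right_mono order_trans powr_ge_zero)
  qed
qed

section \<open>Sums of inverse powers\<close>

text \<open>The numerator of the difference of the two sums of inverse powers over the common denominator
  \<open>(\<Prod>j<2 * \<nu>. z j) ^ k\<close>; the first \<open>\<nu>\<close> variables carry the sign \<open>+\<close>, the others \<open>-\<close>.\<close>
definition inverse_form :: "nat \<Rightarrow> nat \<Rightarrow> (nat \<Rightarrow> int) \<Rightarrow> int" where
  "inverse_form k \<nu> z =
     (\<Sum>i<2 * \<nu>. (if i < \<nu> then 1 else -1) * (\<Prod>j\<in>{..<2 * \<nu>} - {i}. z j) ^ k)"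

text \<open>The extra condition \<open>b dvd a\<close> makes the number of powerful numbers up to \<open>Y\<close> at most the sum of
  the divisor function up to \<open>sqrt Y\<close>.\<close>
lemma powerful_decomposition:
  fixes n :: nat
  assumes "n > 0" and "\<And>p. prime p \<Longrightarrow> p dvd n \<Longrightarrow> p\<^sup>2 dvd n"
  obtains a b where "n = a\<^sup>2 * b" "b dvd a"
proof -
  have "\<exists>a b. n = a\<^sup>2 * b \<and> b dvd a"
    using assms
  proof (induction n rule: less_induct)
    case (less n)
    show ?case
    proof (cases "n = 1")
      case True
      then show ?thesis by (intro exI[of _ 1]) auto
    next
      case False
      then obtain p where p: "prime p" "p dvd n"
        using prime_factor_nat by blast
      define e where "e = multiplicity p n"
      obtain m where m: "n = p ^ e * m" "\<not> p dvd m"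
        unfolding e_def using less.prems(1) p(1) by (elim prime_power_decomposition)
      have m0: "m > 0" using m less.prems by (cases m) auto
      have e: "e \<ge> 2"
        unfolding e_def using less.prems p by (intro multiplicity_geI) (auto simp: prime_gt_Suc_0_nat)
      have mn: "m < n"
        using m m0 one_less_power[OF prime_gt_1_nat[OF p(1)], of e] e by auto
      have "r\<^sup>2 dvd m" if r: "prime r" "r dvd m" for r
      proof -
        have "r\<^sup>2 dvd p ^ e * m" using less.prems(2)[of r] r m by auto
        moreover have "coprime (r\<^sup>2) (p ^ e)"
          using r p m by (metis coprime_power_left_iff coprime_power_right_iff primes_coprime)
        ultimately show ?thesis by (simp add: coprime_dvd_mult_right_iff)
      qed
      then obtain a b where ab: "m = a\<^sup>2 * b" "b dvd a"
        using less.IH[OF mn m0] by blast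
      \<comment> \<open>An odd exponent leaves one factor \<open>p\<close> over, which goes into
        \<open>b\<close>. Since \<open>e \<ge> 2\<close>,
        \<open>e mod 2 \<le> 1 \<le> e div 2\<close>, so the new \<open>b\<close> still divides the
        new \<open>a\<close>.\<close>
      have "n = (p ^ (e div 2) * a)\<^sup>2 * (p ^ (e mod 2) * b)"
      proof -
        have "e = 2 * (e div 2) + e mod 2" by simp
        then have "p ^ e = (p ^ (e div 2))\<^sup>2 * p ^ (e mod 2)"
          by (metis power_add power_even_eq)
        then show ?thesis unfolding m(1) ab(1) by (simp add: power_mult_distrib)
      qed
      moreover have "p ^ (e mod 2) * b dvd p ^ (e div 2) * a"
        using ab e by (intro mult_dvd_mono le_imp_power_dvd) auto
      ultimately show ?thesis by blast
    qed
  qed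
  then show ?thesis using that by blast
qed

text \<open>If \<open>p\<close> divides \<open>z i\<close> but not the product of the other variables, then \<open>p\<close> divides every term of the
  form except the \<open>i\<close>-th one.\<close>
lemma prod_powerful_of_inverse_form_eq_0:
  fixes z :: "nat \<Rightarrow> int"
  assumes k: "k > 0" and z: "inverse_form k \<nu> z = 0"
    and p: "prime p" "p dvd (\<Prod>i<2 * \<nu>. z i)"
  shows "p\<^sup>2 dvd (\<Prod>i<2 * \<nu>. z i)"
proof -
  let ?I = "{..<2 * \<nu>}"
  let ?r = "\<lambda>i. \<Prod>j\<in>?I - {i}. z j"
  obtain i where i: "i \<in> ?I" "p dvd z i"
    using p by (auto simp: prime_dvd_prod_iff)
  have P: "(\<Prod>i\<in>?I. z i) = z i * ?r i"
    using i by (intro prod.remove) auto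
  have "p dvd ?r i"
  proof -
    have "p dvd (\<Sum>l\<in>?I - {i}. (if l < \<nu> then 1 else -1) * ?r l ^ k)"
    proof (intro dvd_sum)
      fix l assume l: "l \<in> ?I - {i}"
      have "z i dvd ?r l" using i l by (intro dvd_prodI) auto
      then have "p dvd ?r l" using i by auto
      then have "p dvd ?r l ^ k" using k by (simp add: dvd_power dvd_trans)
      then show "p dvd (if l < \<nu> then 1 else -1) * ?r l ^ k" by simp
    qed
    moreover have "p dvd (if i < \<nu> then 1 else -1) * ?r i ^ k +
        (\<Sum>l\<in>?I - {i}. (if l < \<nu> then 1 else -1) * ?r l ^ k)"
    proof -
      have "inverse_form k \<nu> z = (if i < \<nu> then 1 else -1) * ?r i ^ k +
          (\<Sum>l\<in>?I - {i}. (if l < \<nu> then 1 else -1) * ?r l ^ k)"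
        using sum.remove[OF finite_lessThan i(1), of "\<lambda>l. (if l < \<nu> then 1 else -1) * ?r l ^ k"]
        by (simp only: inverse_form_def)
      then show ?thesis using z by (metis dvd_0_right)
    qed
    ultimately have "p dvd (if i < \<nu> then 1 else -1) * ?r i ^ k"
      by (simp only: dvd_add_left_iff)
    then have "p dvd ?r i ^ k" by (auto split: if_splits)
    then show ?thesis using p(1) prime_dvd_power by blast
  qed
  then show ?thesis unfolding P using i by (simp add: power2_eq_square mult_dvd_mono)
qed

section \<open>Counting solutions over the integers and on average over the moduli\<close>

lemma card_pos_divisors_int:
  fixes n :: int
  assumes "n \<noteq> 0"
  shows "card {d. d > 0 \<and> d dvd n} = card {d. d dvd nat \<bar>n\<bar>}"
proof -
  have "{d. d > 0 \<and> d dvd n} = int ` {d. d dvd nat \<bar>n\<bar>}"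
  proof (rule Set.set_eqI, rule iffI)
    fix d assume "d \<in> {d. d > 0 \<and> d dvd n}"
    then have "d = int (nat d)" "nat d dvd nat \<bar>n\<bar>"
      by (auto simp: nat_dvd_iff)
    then show "d \<in> int ` {d. d dvd nat \<bar>n\<bar>}" by blast
  next
    fix d assume "d \<in> int ` {d. d dvd nat \<bar>n\<bar>}"
    then obtain e where e: "d = int e" "e dvd nat \<bar>n\<bar>" by blast
    moreover have "e > 0" using e assms by (auto intro!: Nat.gr0I)
    ultimately show "d \<in> {d. d > 0 \<and> d dvd n}" by (auto simp: dvd_nat_abs_iff)
  qed
  then show ?thesis by (simp add: card_image)
qed

text \<open>The modulus \<open>q = 0\<close> is meaningful: it gives the solutions over the integers.\<close>
definition inverse_solutions :: "nat \<Rightarrow> nat \<Rightarrow> int \<Rightarrow> nat \<Rightarrow> (nat \<Rightarrow> int) set" where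
  "inverse_solutions k \<nu> q X =
     {z \<in> {..<2 * \<nu>} \<rightarrow>\<^sub>E {1..int X}. q dvd inverse_form k \<nu> z}"

lemma finite_inverse_solutions [simp]: "finite (inverse_solutions k \<nu> q X)"
  unfolding inverse_solutions_def by (auto intro!: finite_PiE)

text \<open>The product of the variables of a solution is powerful, hence of the form
  \<open>a\<^sup>2 * b\<close> with \<open>b dvd a\<close> and \<open>a \<le> X ^ \<nu>\<close>. By
  the divisor bound there are X^(\<nu>+o(1)) such pairs, and each product has X^(o(1)) tuples of
  divisors.\<close>

lemma card_inverse_solutions_0:
  fixes \<delta> :: real
  assumes "k > 0" and "\<delta> > 0"
  obtains C where "C \<ge> 1"
    "\<And>X. X > 0 \<Longrightarrow> real (card (inverse_solutions k \<nu> 0 X)) \<le> C * real X ^ \<nu> * real X powr \<delta>"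
proof -
  \<comment> \<open>Exponents spent: \<open>\<nu> * h\<close> on the divisors \<open>b\<close> of
    some \<open>a \<le> X ^ \<nu>\<close>, and \<open>3 * \<nu> * h\<close> on each of the
    \<open>2 * \<nu>\<close> variables. The summand 1 keeps the denominator positive for \<nu> =
    0.\<close>
  define h where "h = \<delta> / (real \<nu> + 6 * real \<nu> * real \<nu> + 1)"
  have h0: "h > 0" unfolding h_def using assms by (intro divide_pos_pos add_nonneg_pos) auto
  have hd: "(real \<nu> + 6 * real \<nu> * real \<nu>) * h \<le> \<delta>"
  proof -
    have "(real \<nu> + 6 * real \<nu> * real \<nu>) * \<delta> \<le> (real \<nu> + 6 * real \<nu> * real \<nu> + 1) * \<delta>"
      using assms by (intro mult_right_mono) auto
    moreover have "real \<nu> + 6 * real \<nu> * real \<nu> + 1 > 0" by (intro add_nonneg_pos) auto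
    ultimately show ?thesis unfolding h_def by (simp add: pos_divide_le_eq mult.commute)
  qed
  obtain C where C: "C \<ge> 1" "\<And>n::nat. n > 0 \<Longrightarrow> real (card {d. d dvd n}) \<le> C * real n powr h"
    using divisor_bound[OF h0] by blast
  show ?thesis
  proof (rule that[of "C ^ (2 * \<nu> + 1)"])
    show "C ^ (2 * \<nu> + 1) \<ge> 1" using C(1) by (rule one_le_power)
    fix X :: nat assume X: "X > 0"
    define S where "S = (SIGMA a:{1..X ^ \<nu>}. {b. b dvd a})"
    \<comment> \<open>Only divisibility of \<open>a\<^sup>2 * b\<close> by each single variable is
      kept, not the value of their product; the overcount is a power of the divisor
      function.\<close>
    define V where "V = (\<lambda>(a, b). {..<2 * \<nu>} \<rightarrow>\<^sub>E {d::int. d > 0 \<and> d dvd int (a\<^sup>2 * b)})"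
    have finS: "finite S" unfolding S_def by (intro finite_SigmaI) auto
    have pos: "a\<^sup>2 * b > 0" if "(a, b) \<in> S" for a b
      using that dvd_pos_nat by (auto simp: S_def)
    have finD: "finite {d::int. d > 0 \<and> d dvd int (a\<^sup>2 * b)}" if "(a, b) \<in> S" for a b
      using pos[OF that] by (intro finite_subset[OF _ finite_divisors_int[of "int (a\<^sup>2 * b)"]]) auto
    have sub: "inverse_solutions k \<nu> 0 X \<subseteq> (\<Union>s\<in>S. V s)"
    proof
      fix z assume z: "z \<in> inverse_solutions k \<nu> 0 X"
      then have z0: "inverse_form k \<nu> z = 0" and zP: "z \<in> {..<2 * \<nu>} \<rightarrow>\<^sub>E {1..int X}"
        by (auto simp: inverse_solutions_def)
      define P where "P = (\<Prod>i<2 * \<nu>. z i)"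
      have zb: "1 \<le> z i \<and> z i \<le> int X" if "i < 2 * \<nu>" for i using zP that by (auto simp: PiE_def Pi_def)
      have P0: "P > 0" unfolding P_def by (intro prod_pos) (use zb in fastforce)
      have "P \<le> (\<Prod>i<2 * \<nu>. int X)" unfolding P_def by (intro prod_mono) (use zb in fastforce)
      then have PX: "P \<le> int (X ^ (2 * \<nu>))" by simp
      define n where "n = nat P"
      have n: "P = int n" "n > 0" using P0 by (auto simp: n_def)
      have "p\<^sup>2 dvd n" if p: "prime p" "p dvd n" for p
      proof -
        have "(int p)\<^sup>2 dvd P"
          unfolding P_def
          by (rule prod_powerful_of_inverse_form_eq_0[OF assms(1) z0])
            (use p n in \<open>simp_all flip: P_def\<close>)
        then show ?thesis unfolding n(1) by (simp flip: of_nat_power)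
      qed
      then obtain a b where ab: "n = a\<^sup>2 * b" "b dvd a"
        using powerful_decomposition[OF n(2)] by metis
      have ab0: "a > 0" "b > 0" using ab n by (auto intro!: Nat.gr0I)
      have "a\<^sup>2 \<le> a\<^sup>2 * b" using ab0 by simp
      also have "\<dots> \<le> X ^ (2 * \<nu>)" using PX unfolding n(1) ab(1) by (simp only: of_nat_le_iff)
      also have "\<dots> = (X ^ \<nu>)\<^sup>2" by (simp add: power_mult[symmetric] mult.commute)
      finally have "a \<le> X ^ \<nu>" by (simp add: power2_nat_le_eq_le)
      then have "(a, b) \<in> S" using ab ab0 by (auto simp: S_def)
      moreover have "z \<in> V (a, b)"
      proof -
        have "z i dvd int (a\<^sup>2 * b) \<and> z i > 0" if "i < 2 * \<nu>" for i
        proof -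
          have "z i dvd P" unfolding P_def using that by (intro dvd_prodI) auto
          moreover have "P = int (a\<^sup>2 * b)" using ab(1) n(1) by simp
          ultimately show ?thesis using zb[OF that] by simp
        qed
        then show ?thesis using zP by (auto simp: V_def PiE_def Pi_def)
      qed
      ultimately show "z \<in> (\<Union>s\<in>S. V s)" by blast
    qed
    have cV: "real (card (V s)) \<le> (C * real X powr (3 * real \<nu> * h)) ^ (2 * \<nu>)" if s: "s \<in> S" for s
    proof -
      obtain a b where ab: "s = (a, b)" by (cases s)
      have aX: "a \<le> X ^ \<nu>" "a > 0" "b dvd a" using s ab by (auto simp: S_def)
      have bX: "b \<le> X ^ \<nu>" using dvd_imp_le[OF aX(3,2)] aX(1) by (rule order_trans)
      \<comment> \<open>A pair in \<open>S\<close> need not come from a solution, so only the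
        separate bounds on \<open>a\<close> and \<open>b\<close> are at hand; this gives the
        exponent \<open>3 * \<nu>\<close> instead of \<open>2 * \<nu>\<close>.\<close>
      have "a\<^sup>2 * b \<le> (X ^ \<nu>)\<^sup>2 * X ^ \<nu>" using aX bX by (intro mult_le_mono power_mono) auto
      also have "\<dots> = X ^ (3 * \<nu>)"
        by (simp add: power_mult[symmetric] power_add[symmetric] mult.commute)
      finally have "real (a\<^sup>2 * b) \<le> real (X ^ (3 * \<nu>))" by (rule of_nat_mono)
      also have "\<dots> = real X powr (3 * real \<nu>)"
        using X powr_realpow[of "real X" "3 * \<nu>"] by simp
      finally have n: "real (a\<^sup>2 * b) \<le> real X powr (3 * real \<nu>)" .
      have "card {d::int. d > 0 \<and> d dvd int (a\<^sup>2 * b)} = card {d. d dvd a\<^sup>2 * b}"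
        using card_pos_divisors_int[of "int (a\<^sup>2 * b)"] pos s ab by (simp only: abs_of_nat nat_int) simp
      then have "real (card {d::int. d > 0 \<and> d dvd int (a\<^sup>2 * b)}) \<le> C * real (a\<^sup>2 * b) powr h"
        using C(2)[OF pos] s ab by metis
      also have "\<dots> \<le> C * (real X powr (3 * real \<nu>)) powr h"
        using n C h0 by (intro mult_left_mono powr_mono2) auto
      finally have "real (card {d::int. d > 0 \<and> d dvd int (a\<^sup>2 * b)}) \<le> C * real X powr (3 * real \<nu> * h)"
        by (simp only: powr_powr)
      then have "real (card {d::int. d > 0 \<and> d dvd int (a\<^sup>2 * b)}) ^ (2 * \<nu>)
          \<le> (C * real X powr (3 * real \<nu> * h)) ^ (2 * \<nu>)"
        by (intro power_mono) auto
      then show ?thesis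
        unfolding ab V_def by (simp add: card_PiE)
    qed
    have cS: "real (card S) \<le> real X ^ \<nu> * (C * real X powr (real \<nu> * h))"
    proof -
      have "real (card S) = (\<Sum>a\<in>{1..X ^ \<nu>}. real (card {b. b dvd a}))"
        unfolding S_def by (subst card_SigmaI) auto
      also have "\<dots> \<le> (\<Sum>a\<in>{1..X ^ \<nu>}. C * real X powr (real \<nu> * h))"
      proof (intro sum_mono)
        fix a assume a: "a \<in> {1..X ^ \<nu>}"
        then have "real a \<le> real (X ^ \<nu>)" by (intro of_nat_mono) simp
        also have "\<dots> = real X powr real \<nu>"
          using X powr_realpow[of "real X" \<nu>] by simp
        finally have "real a \<le> real X powr real \<nu>" .
        then have "C * real a powr h \<le> C * (real X powr real \<nu>) powr h"
          using C h0 by (intro mult_left_mono powr_mono2) auto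
        then show "real (card {b. b dvd a}) \<le> C * real X powr (real \<nu> * h)"
          using C(2)[of a] a by (simp only: powr_powr) auto
      qed
      also have "\<dots> = real X ^ \<nu> * (C * real X powr (real \<nu> * h))" by simp
      finally show ?thesis .
    qed
    have "card (inverse_solutions k \<nu> 0 X) \<le> card (\<Union>s\<in>S. V s)"
      using sub finS finD by (intro card_mono finite_UN_I) (auto simp: V_def intro!: finite_PiE)
    also have "\<dots> \<le> (\<Sum>s\<in>S. card (V s))" using finS by (rule card_UN_le)
    finally have "real (card (inverse_solutions k \<nu> 0 X)) \<le> (\<Sum>s\<in>S. real (card (V s)))"
      by (metis of_nat_le_iff of_nat_sum)
    also have "\<dots> \<le> (\<Sum>s\<in>S. (C * real X powr (3 * real \<nu> * h)) ^ (2 * \<nu>))"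
      using cV by (intro sum_mono)
    also have "\<dots> = real (card S) * (C * real X powr (3 * real \<nu> * h)) ^ (2 * \<nu>)" by simp
    also have "\<dots> \<le> (real X ^ \<nu> * (C * real X powr (real \<nu> * h))) * (C * real X powr (3 * real \<nu> * h)) ^ (2 * \<nu>)"
      using cS C by (intro mult_right_mono) auto
    also have "\<dots> = C ^ (2 * \<nu> + 1) * real X ^ \<nu> * (real X powr (real \<nu> * h) * (real X powr (3 * real \<nu> * h)) ^ (2 * \<nu>))"
      by (simp add: power_mult_distrib)
    also have "(real X powr (3 * real \<nu> * h)) ^ (2 * \<nu>) = real X powr (6 * real \<nu> * real \<nu> * h)"
    proof -
      have "(real X powr (3 * real \<nu> * h)) ^ (2 * \<nu>) = (real X powr (3 * real \<nu> * h)) powr real (2 * \<nu>)"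
        using X by (intro powr_realpow[symmetric]) simp
      then show ?thesis by (simp add: powr_powr mult_ac)
    qed
    also have "real X powr (real \<nu> * h) * real X powr (6 * real \<nu> * real \<nu> * h)
        = real X powr ((real \<nu> + 6 * real \<nu> * real \<nu>) * h)"
      by (simp add: powr_add[symmetric] algebra_simps)
    also have "C ^ (2 * \<nu> + 1) * real X ^ \<nu> * real X powr ((real \<nu> + 6 * real \<nu> * real \<nu>) * h)
       \<le> C ^ (2 * \<nu> + 1) * real X ^ \<nu> * real X powr \<delta>"
      using hd X C by (intro mult_left_mono powr_mono) auto
    finally show "real (card (inverse_solutions k \<nu> 0 X)) \<le> C ^ (2 * \<nu> + 1) * real X ^ \<nu> * real X powr \<delta>" .
  qed
qed

text \<open>Each term is the \<open>k\<close>-th power of a product of \<open>2 * \<nu> - 1\<close>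
  variables, rounded up to \<open>2 * \<nu>\<close> factors \<open>X\<close>. Any bound polynomial
  in \<open>X\<close> serves the divisor bound.\<close>

lemma abs_inverse_form_le:
  assumes "z \<in> {..<2 * \<nu>} \<rightarrow>\<^sub>E {1..int X}"
  shows "\<bar>inverse_form k \<nu> z\<bar> \<le> int (2 * \<nu> * X ^ (2 * \<nu> * k))"
proof -
  have z: "1 \<le> z i \<and> z i \<le> int X" if "i < 2 * \<nu>" for i
    using assms that by (auto simp: PiE_def Pi_def)
  have "\<bar>inverse_form k \<nu> z\<bar> \<le> (\<Sum>i<2 * \<nu>. \<bar>(if i < \<nu> then 1 else -1) * (\<Prod>j\<in>{..<2 * \<nu>} - {i}. z j) ^ k\<bar>)"
    unfolding inverse_form_def by (rule sum_abs)
  also have "\<dots> \<le> (\<Sum>i<2 * \<nu>. int X ^ (2 * \<nu> * k))"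
  proof (intro sum_mono)
    fix i assume i: "i \<in> {..<2 * \<nu>}"
    have X: "int X \<ge> 1" using z[of i] i by auto
    have p0: "0 \<le> (\<Prod>j\<in>{..<2 * \<nu>} - {i}. z j)"
      by (intro prod_nonneg) (use z in fastforce)
    have "(\<Prod>j\<in>{..<2 * \<nu>} - {i}. z j) \<le> (\<Prod>j\<in>{..<2 * \<nu>} - {i}. int X)"
      by (intro prod_mono) (use z in fastforce)
    also have "\<dots> \<le> int X ^ (2 * \<nu>)"
      using X i by (simp add: power_increasing)
    finally have "(\<Prod>j\<in>{..<2 * \<nu>} - {i}. z j) ^ k \<le> (int X ^ (2 * \<nu>)) ^ k"
      using p0 by (rule power_mono)
    then show "\<bar>(if i < \<nu> then 1 else -1) * (\<Prod>j\<in>{..<2 * \<nu>} - {i}. z j) ^ k\<bar> \<le> int X ^ (2 * \<nu> * k)"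
      using p0 by (simp add: abs_mult power_mult)
  qed
  also have "\<dots> = int (2 * \<nu> * X ^ (2 * \<nu> * k))" by simp
  finally show ?thesis .
qed

text \<open>Double counting of pairs of a modulus and a tuple. A tuple in \<open>Z\<close> counts
  for all of \<open>M\<close>, but \<open>Z\<close> is small; for any other tuple the moduli are
  positive divisors of a nonzero integer, so there are X^(o(1)) of them.\<close>

lemma sum_card_inverse_solutions:
  fixes \<delta> :: real
  assumes "k > 0" and "\<delta> > 0"
  obtains C where "C \<ge> 1"
    "\<And>X M. X > 0 \<Longrightarrow> finite M \<Longrightarrow> (\<And>q. q \<in> M \<Longrightarrow> q > 0) \<Longrightarrow>
       (\<Sum>q\<in>M. real (card (inverse_solutions k \<nu> q X)))
         \<le> C * real X powr \<delta> * (real X ^ \<nu> * real (card M) + real X ^ (2 * \<nu>))"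
proof -
  \<comment> \<open>The form has size O(X^(2 \<nu> k)), so its divisor count costs the exponent
    \<open>2 * \<nu> * k * h\<close>, which must not exceed \<delta>.\<close>
  define h where "h = \<delta> / (2 * real \<nu> * real k + 1)"
  have h0: "h > 0" unfolding h_def using assms by (intro divide_pos_pos add_nonneg_pos) auto
  have hd: "(2 * real \<nu> * real k) * h \<le> \<delta>"
  proof -
    have "(2 * real \<nu> * real k) * \<delta> \<le> (2 * real \<nu> * real k + 1) * \<delta>"
      using assms by (intro mult_right_mono) auto
    moreover have "2 * real \<nu> * real k + 1 > 0" by (intro add_nonneg_pos) auto
    ultimately show ?thesis unfolding h_def by (simp add: pos_divide_le_eq mult.commute)
  qed
  obtain C1 where C1: "C1 \<ge> 1" "\<And>n::nat. n > 0 \<Longrightarrow> real (card {d. d dvd n}) \<le> C1 * real n powr h"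
    using divisor_bound[OF h0] by blast
  obtain C2 where C2: "C2 \<ge> 1"
    "\<And>X. X > 0 \<Longrightarrow> real (card (inverse_solutions k \<nu> 0 X)) \<le> C2 * real X ^ \<nu> * real X powr \<delta>"
    using card_inverse_solutions_0[OF assms] by blast
  define C3 where "C3 = C1 * (2 * real \<nu> + 1) powr h"
  have C3: "C3 \<ge> 0" using C1 by (simp add: C3_def)
  show ?thesis
  proof (rule that[of "max C2 C3"])
    show "max C2 C3 \<ge> 1" using C2 by simp
    fix X :: nat and M :: "int set"
    assume X: "X > 0" and M: "finite M" "\<And>q. q \<in> M \<Longrightarrow> q > 0"
    define U where "U = {..<2 * \<nu>} \<rightarrow>\<^sub>E {1..int X}"
    define Z where "Z = inverse_solutions k \<nu> 0 X"
    have finU: "finite U" unfolding U_def by (intro finite_PiE) auto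
    have ZU: "Z \<subseteq> U" by (auto simp: Z_def U_def inverse_solutions_def)
    have cU: "real (card U) = real X ^ (2 * \<nu>)" by (simp add: U_def card_PiE)
    define c where "c z = card {q \<in> M. q dvd inverse_form k \<nu> z}" for z
    have cz: "real (c z) \<le> C3 * real X powr \<delta>" if z: "z \<in> U - Z" for z
    proof -
      let ?D = "inverse_form k \<nu> z"
      have D0: "?D \<noteq> 0" using z by (auto simp: Z_def U_def inverse_solutions_def)
      have "c z \<le> card {d. d > 0 \<and> d dvd ?D}"
        unfolding c_def using M D0
        by (intro card_mono finite_subset[OF _ finite_divisors_int[OF D0]]) auto
      then have "real (c z) \<le> C1 * real (nat \<bar>?D\<bar>) powr h"
        using C1(2)[of "nat \<bar>?D\<bar>"] D0 unfolding card_pos_divisors_int[OF D0] by simp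
      also have "\<dots> \<le> C1 * ((2 * real \<nu> + 1) * real X powr (2 * real \<nu> * real k)) powr h"
      proof -
        have "nat \<bar>?D\<bar> \<le> 2 * \<nu> * X ^ (2 * \<nu> * k)"
          using abs_inverse_form_le[of z \<nu> X k] z unfolding U_def by (simp only: nat_le_iff Diff_iff)
        then have "real (nat \<bar>?D\<bar>) \<le> real (2 * \<nu> * X ^ (2 * \<nu> * k))"
          by (rule of_nat_mono)
        also have "\<dots> \<le> (2 * real \<nu> + 1) * real X ^ (2 * \<nu> * k)"
          by (simp add: mult_right_mono)
        also have "real X ^ (2 * \<nu> * k) = real X powr (2 * real \<nu> * real k)"
          using X powr_realpow[of "real X" "2 * \<nu> * k"] by simp
        finally show ?thesis using h0 C1 by (intro mult_left_mono powr_mono2) auto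
      qed
      also have "\<dots> = C3 * real X powr (2 * real \<nu> * real k * h)"
        by (simp add: C3_def powr_mult powr_powr)
      also have "\<dots> \<le> C3 * real X powr \<delta>"
        using hd X C3 by (intro mult_left_mono powr_mono) auto
      finally show ?thesis .
    qed
    have "(\<Sum>q\<in>M. real (card (inverse_solutions k \<nu> q X)))
        = (\<Sum>q\<in>M. \<Sum>z\<in>U. if q dvd inverse_form k \<nu> z then 1 else 0)"
      by (simp add: inverse_solutions_def U_def[symmetric] sum.If_cases finU Int_def)
    also have "\<dots> = (\<Sum>z\<in>U. real (c z))"
      by (subst sum.swap) (simp add: c_def sum.If_cases M(1) Int_def)
    also have "\<dots> = (\<Sum>z\<in>U - Z. real (c z)) + (\<Sum>z\<in>Z. real (c z))"
      by (rule sum.subset_diff[OF ZU finU])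
    also have "\<dots> \<le> (\<Sum>z\<in>U - Z. C3 * real X powr \<delta>) + (\<Sum>z\<in>Z. real (card M))"
      using cz M by (intro add_mono sum_mono) (auto simp: c_def intro!: card_mono)
    also have "\<dots> \<le> real (card U) * (C3 * real X powr \<delta>) + real (card Z) * real (card M)"
    proof -
      have "card (U - Z) \<le> card U" using finU by (intro card_mono) auto
      then show ?thesis using C3 by (simp add: mult_right_mono)
    qed
    also have "\<dots> \<le> real X ^ (2 * \<nu>) * (max C2 C3 * real X powr \<delta>)
        + (max C2 C3 * real X ^ \<nu> * real X powr \<delta>) * real (card M)"
    proof -
      have "real (card Z) \<le> C2 * real X ^ \<nu> * real X powr \<delta>" unfolding Z_def by (rule C2(2)[OF X])
      also have "\<dots> \<le> max C2 C3 * real X ^ \<nu> * real X powr \<delta>"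
        by (intro mult_right_mono) auto
      finally show ?thesis
        unfolding cU by (intro add_mono mult_left_mono mult_right_mono) auto
    qed
    also have "\<dots> = max C2 C3 * real X powr \<delta> * (real X ^ \<nu> * real (card M) + real X ^ (2 * \<nu>))"
      by (simp add: algebra_simps)
    finally show "(\<Sum>q\<in>M. real (card (inverse_solutions k \<nu> q X)))
         \<le> max C2 C3 * real X powr \<delta> * (real X ^ \<nu> * real (card M) + real X ^ (2 * \<nu>))" .
  qed
qed

section \<open>Exceptional moduli\<close>

text \<open>The number of dyadic scales up to \<open>x\<close> is logarithmic. It is paid for twice:
  when all scales are required to be good at once, and when the blocks of the form are added
  up.\<close>

lemma card_powers_of_2_le:
  fixes \<delta> :: real
  assumes "\<delta> > 0"
  obtains C where "C \<ge> 1" "\<And>x::real. x \<ge> 1 \<Longrightarrow> finite {i::nat. 2 ^ i \<le> x}"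
    "\<And>x::real. x \<ge> 1 \<Longrightarrow> real (card {i::nat. 2 ^ i \<le> x}) \<le> C * x powr \<delta>"
proof -
  \<comment> \<open>The first summand comes from
    \<open>ln x \<le> x powr \<delta> / \<delta>\<close>, the second from the scale
    \<open>i = 0\<close>.\<close>
  define K where "K = 1 / (ln 2 * \<delta>) + 1"
  have sub: "{i::nat. 2 ^ i \<le> x} \<subseteq> {..nat \<lfloor>log 2 x\<rfloor>}" if "x \<ge> 1" for x :: real
  proof
    fix i :: nat assume "i \<in> {i. 2 ^ i \<le> x}"
    then have "real i \<le> log 2 x"
      using that by (simp add: le_log_iff powr_realpow)
    then have "int i \<le> \<lfloor>log 2 x\<rfloor>" by (simp add: le_floor_iff)
    then show "i \<in> {..nat \<lfloor>log 2 x\<rfloor>}" by simp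
  qed
  show ?thesis
  proof (rule that[of K])
    show "K \<ge> 1" using assms by (simp add: K_def)
    fix x :: real assume x: "x \<ge> 1"
    show "finite {i::nat. 2 ^ i \<le> x}" using sub[OF x] finite_subset by blast
    have l0: "log 2 x \<ge> 0" using x by simp
    have "card {i::nat. 2 ^ i \<le> x} \<le> card {..nat \<lfloor>log 2 x\<rfloor>}"
      by (rule card_mono[OF _ sub[OF x]]) simp
    then have "real (card {i::nat. 2 ^ i \<le> x}) \<le> real (nat \<lfloor>log 2 x\<rfloor>) + 1" by simp
    also have "\<dots> \<le> log 2 x + 1" using l0 by (simp add: of_nat_floor)
    also have "\<dots> \<le> (x powr \<delta> / \<delta>) / ln 2 + x powr \<delta>"
      unfolding log_def using ln_powr_bound[OF x assms] x assms
      by (intro add_mono divide_right_mono ge_one_powr_ge_zero) auto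
    also have "\<dots> = K * x powr \<delta>" using assms by (simp add: K_def field_simps)
    finally show "real (card {i::nat. 2 ^ i \<le> x}) \<le> K * x powr \<delta>" .
  qed
qed

lemma card_integers_between_le:
  fixes Q :: real
  assumes "Q \<ge> 1"
  shows "finite {q::int. Q \<le> real_of_int q \<and> real_of_int q \<le> 2 * Q}"
    and "real (card {q::int. Q \<le> real_of_int q \<and> real_of_int q \<le> 2 * Q}) \<le> Q + 1"
proof -
  have eq: "{q::int. Q \<le> real_of_int q \<and> real_of_int q \<le> 2 * Q} = {\<lceil>Q\<rceil>..\<lfloor>2 * Q\<rfloor>}"
    by (auto simp: ceiling_le_iff le_floor_iff)
  show "finite {q::int. Q \<le> real_of_int q \<and> real_of_int q \<le> 2 * Q}" unfolding eq by simp
  have "real_of_int (\<lfloor>2 * Q\<rfloor> - \<lceil>Q\<rceil> + 1) \<le> Q + 1"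
    using of_int_floor_le[of "2 * Q"] le_of_int_ceiling[of Q] unfolding of_int_add of_int_diff of_int_1
    by linarith
  then show "real (card {q::int. Q \<le> real_of_int q \<and> real_of_int q \<le> 2 * Q}) \<le> Q + 1"
    unfolding eq using assms by (simp add: of_nat_nat)
qed

text \<open>Markov's inequality, for all scales together: on average over the moduli, the count at X
  = 2^i is X^\<nu> + X^(2\<nu>)/Q up to Q^(o(1)), and an exceptional modulus exceeds this order by
  \<open>Q powr (3 * \<epsilon> / 2)\<close> at some scale.\<close>

lemma card_exceptional_moduli:
  fixes \<epsilon> :: real
  assumes "k > 0" and "\<epsilon> > 0"
  obtains C where "C > 0"
    "\<And>Q. Q \<ge> 1 \<Longrightarrow>
      real (card {q::int. Q \<le> real_of_int q \<and> real_of_int q \<le> 2 * Q \<and>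
        (\<exists>i. 2 ^ i \<le> 4 * Q \<and> real (card (inverse_solutions k \<nu> q (2 ^ i)))
           > ((2 ^ i) ^ \<nu> + (2 ^ i) ^ (2 * \<nu>) / Q) * Q powr (3 * \<epsilon> / 2))})
      \<le> C * Q powr (1 - \<epsilon>)"
proof -
  \<comment> \<open>\<delta> is lost twice, in the mean value and in the number of scales. With
    \<delta> = \<epsilon>/4 the exponent of the excess drops from 3\<epsilon>/2 to
    \<epsilon>.\<close>
  define \<delta> where "\<delta> = \<epsilon> / 4"
  have d: "\<delta> > 0" using assms by (simp add: \<delta>_def)
  obtain C1 where C1: "C1 \<ge> 1"
    "\<And>X M. X > 0 \<Longrightarrow> finite M \<Longrightarrow> (\<And>q. q \<in> M \<Longrightarrow> q > 0) \<Longrightarrow>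
       (\<Sum>q\<in>M. real (card (inverse_solutions k \<nu> q X)))
         \<le> C1 * real X powr \<delta> * (real X ^ \<nu> * real (card M) + real X ^ (2 * \<nu>))"
    using sum_card_inverse_solutions[OF assms(1) d] by blast
  obtain C2 where C2: "C2 \<ge> 1" "\<And>x::real. x \<ge> 1 \<Longrightarrow> finite {i::nat. 2 ^ i \<le> x}"
    "\<And>x::real. x \<ge> 1 \<Longrightarrow> real (card {i::nat. 2 ^ i \<le> x}) \<le> C2 * x powr \<delta>"
    using card_powers_of_2_le[OF d] by blast
  define C where "C = 2 * C1 * C2 * 4 powr (2 * \<delta>)"
  show ?thesis
  proof (rule that[of C])
    show "C > 0" using C1 C2 by (simp add: C_def)
    fix Q :: real assume Q: "Q \<ge> 1"
    define M where "M = {q::int. Q \<le> real_of_int q \<and> real_of_int q \<le> 2 * Q}"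
    define I where "I = {i::nat. 2 ^ i \<le> 4 * Q}"
    \<comment> \<open>\<open>w i\<close> is \<open>Q\<close> times the expected order, that is, the
      order of the sum of the counts over all moduli. Dividing by it makes the scales comparable, so
      one sum over \<open>I\<close> detects an excess at any of them.\<close>
    define w where "w i = (2 ^ i) ^ \<nu> * Q + (2 ^ i) ^ (2 * \<nu>)" for i :: nat
    define J where "J q i = real (card (inverse_solutions k \<nu> q (2 ^ i)))" for q i
    define B where "B = {q \<in> M. \<exists>i\<in>I. J q i > ((2 ^ i) ^ \<nu> + (2 ^ i) ^ (2 * \<nu>) / Q) * Q powr (3 * \<epsilon> / 2)}"
    have M: "finite M" "real (card M) \<le> Q + 1" "\<And>q. q \<in> M \<Longrightarrow> q > 0"
      using card_integers_between_le[OF Q] Q by (auto simp: M_def)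
    have I: "finite I" "real (card I) \<le> C2 * (4 * Q) powr \<delta>"
      using C2(2,3)[of "4 * Q"] Q by (auto simp: I_def)
    have w: "w i > 0" for i unfolding w_def using Q by (intro add_pos_pos mult_pos_pos) auto
    have BM: "B \<subseteq> M" by (auto simp: B_def)
    have "real (card B) * Q powr (3 * \<epsilon> / 2 - 1) = (\<Sum>q\<in>B. Q powr (3 * \<epsilon> / 2 - 1))" by simp
    also have "\<dots> \<le> (\<Sum>q\<in>B. \<Sum>i\<in>I. J q i / w i)"
    proof (intro sum_mono)
      fix q assume "q \<in> B"
      then obtain i where i: "i \<in> I" "J q i > ((2 ^ i) ^ \<nu> + (2 ^ i) ^ (2 * \<nu>) / Q) * Q powr (3 * \<epsilon> / 2)"
        by (auto simp: B_def)
      have "((2 ^ i) ^ \<nu> + (2 ^ i) ^ (2 * \<nu>) / Q) * Q powr (3 * \<epsilon> / 2) = w i * Q powr (3 * \<epsilon> / 2 - 1)"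
      proof -
        have "Q powr (3 * \<epsilon> / 2 - 1) = Q powr (3 * \<epsilon> / 2) / Q"
          using Q by (simp add: powr_diff)
        then show ?thesis using Q by (simp only: w_def) (simp add: field_simps)
      qed
      then have "Q powr (3 * \<epsilon> / 2 - 1) \<le> J q i / w i"
        using i(2) w[of i] by (simp add: pos_le_divide_eq mult.commute)
      also have "\<dots> \<le> (\<Sum>i\<in>I. J q i / w i)"
        using i(1) I(1) w by (intro member_le_sum) (auto simp: J_def less_imp_le)
      finally show "Q powr (3 * \<epsilon> / 2 - 1) \<le> (\<Sum>i\<in>I. J q i / w i)" .
    qed
    also have "\<dots> \<le> (\<Sum>q\<in>M. \<Sum>i\<in>I. J q i / w i)"
      using M BM w by (intro sum_mono2 sum_nonneg divide_nonneg_pos) (auto simp: J_def)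
    also have "\<dots> = (\<Sum>i\<in>I. (\<Sum>q\<in>M. J q i) / w i)"
      by (subst sum.swap) (simp add: sum_divide_distrib)
    also have "\<dots> \<le> (\<Sum>i\<in>I. 2 * C1 * (4 * Q) powr \<delta>)"
    proof (intro sum_mono)
      fix i assume i: "i \<in> I"
      have "(\<Sum>q\<in>M. J q i) \<le> C1 * (2 ^ i) powr \<delta> * ((2 ^ i) ^ \<nu> * real (card M) + (2 ^ i) ^ (2 * \<nu>))"
        using C1(2)[of "2 ^ i" M] M by (simp add: J_def)
      also have "\<dots> \<le> C1 * (4 * Q) powr \<delta> * (2 * w i)"
      proof (intro mult_mono)
        have le: "(2 ^ i) ^ \<nu> * real (card M) \<le> (2 ^ i) ^ \<nu> * (2 * Q)"
          using M(2) Q by (intro mult_left_mono) auto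
        have "a * c + b \<le> 2 * (a * Q + b)" if "a * c \<le> a * (2 * Q)" "0 \<le> b" for a b c :: real
          using that by (simp add: algebra_simps)
        from this[OF le] show "(2 ^ i) ^ \<nu> * real (card M) + (2 ^ i) ^ (2 * \<nu>) \<le> 2 * w i"
          unfolding w_def by simp
        show "(2 ^ i) powr \<delta> \<le> (4 * Q) powr \<delta>"
          using i d by (intro powr_mono2) (auto simp: I_def)
      qed (use C1 w in auto)
      finally show "(\<Sum>q\<in>M. J q i) / w i \<le> 2 * C1 * (4 * Q) powr \<delta>"
        using w[of i] by (simp add: pos_divide_le_eq mult_ac)
    qed
    also have "\<dots> = real (card I) * (2 * C1 * (4 * Q) powr \<delta>)" by simp
    also have "\<dots> \<le> (C2 * (4 * Q) powr \<delta>) * (2 * C1 * (4 * Q) powr \<delta>)"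
      using I C1 by (intro mult_right_mono) auto
    also have "\<dots> = 2 * C1 * C2 * (4 * Q) powr (2 * \<delta>)"
    proof -
      have "(4 * Q) powr (2 * \<delta>) = (4 * Q) powr \<delta> * (4 * Q) powr \<delta>"
        by (simp add: powr_add[symmetric])
      then show ?thesis by simp
    qed
    also have "\<dots> = C * Q powr (2 * \<delta>)" using Q by (simp add: C_def powr_mult)
    finally have "real (card B) \<le> C * Q powr (2 * \<delta>) / Q powr (3 * \<epsilon> / 2 - 1)"
      using Q by (simp add: pos_le_divide_eq)
    also have "\<dots> = C * Q powr (2 * \<delta> - (3 * \<epsilon> / 2 - 1))" by (simp add: powr_diff)
    also have "2 * \<delta> - (3 * \<epsilon> / 2 - 1) = 1 - \<epsilon>" by (simp add: \<delta>_def field_simps)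
    finally have "real (card B) \<le> C * Q powr (1 - \<epsilon>)" .
    moreover have "{q::int. Q \<le> real_of_int q \<and> real_of_int q \<le> 2 * Q \<and>
        (\<exists>i. 2 ^ i \<le> 4 * Q \<and> real (card (inverse_solutions k \<nu> q (2 ^ i)))
           > ((2 ^ i) ^ \<nu> + (2 ^ i) ^ (2 * \<nu>) / Q) * Q powr (3 * \<epsilon> / 2))} = B"
      by (auto simp: B_def M_def I_def J_def)
    ultimately show "real (card {q::int. Q \<le> real_of_int q \<and> real_of_int q \<le> 2 * Q \<and>
        (\<exists>i. 2 ^ i \<le> 4 * Q \<and> real (card (inverse_solutions k \<nu> q (2 ^ i)))
           > ((2 ^ i) ^ \<nu> + (2 ^ i) ^ (2 * \<nu>) / Q) * Q powr (3 * \<epsilon> / 2))})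
      \<le> C * Q powr (1 - \<epsilon>)" by simp
  qed
qed

section \<open>Hoelder's inequality and additive characters\<close>

lemma convex_on_power_nonneg: "convex_on {0::real..} (\<lambda>x. x ^ n)"
proof (cases "even n")
  case True
  then show ?thesis
    using convex_on_subset[OF convex_power_even[OF True], of "{0..}"] by simp
qed (rule convex_power_odd)

text \<open>Jensen's inequality for the \<nu>-th power with the probability weights
  \<open>a i / A\<close> gives \<open>R ^ \<nu> \<le> A ^ (\<nu> - 1) * (\<Sum>i\<in>S. a i * T i ^
  \<nu>)\<close>. Cauchy-Schwarz then separates \<open>a\<close> from \<open>T\<close>, and a
  \<nu>-th root finishes.\<close>

lemma holder_sum_le:
  fixes a T :: "'i \<Rightarrow> real"
  assumes S: "finite S" and nu: "\<nu> > 0"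
    and a: "\<And>i. i \<in> S \<Longrightarrow> a i \<ge> 0" and T: "\<And>i. i \<in> S \<Longrightarrow> T i \<ge> 0"
  shows "(\<Sum>i\<in>S. a i * T i) \<le> (\<Sum>i\<in>S. a i) powr (1 - 1 / real \<nu>)
    * sqrt (\<Sum>i\<in>S. (a i)\<^sup>2) powr (1 / real \<nu>) * (\<Sum>i\<in>S. T i ^ (2 * \<nu>)) powr (1 / (2 * real \<nu>))"
proof (cases "(\<Sum>i\<in>S. a i) = 0")
  case True
  then have "\<And>i. i \<in> S \<Longrightarrow> a i = 0" using S a by (simp add: sum_nonneg_eq_0_iff)
  then show ?thesis by simp
next
  case False
  define A where "A = (\<Sum>i\<in>S. a i)"
  define B where "B = sqrt (\<Sum>i\<in>S. (a i)\<^sup>2)"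
  define M where "M = (\<Sum>i\<in>S. T i ^ (2 * \<nu>))"
  define R where "R = (\<Sum>i\<in>S. a i * T i)"
  have A0: "A > 0" unfolding A_def using False a by (simp add: sum_nonneg less_le)
  have S0: "S \<noteq> {}" using False by auto
  have B0: "B \<ge> 0" unfolding B_def by (intro real_sqrt_ge_zero sum_nonneg) auto
  have M0: "M \<ge> 0" unfolding M_def by (intro sum_nonneg) auto
  have R0: "R \<ge> 0" unfolding R_def using a T by (intro sum_nonneg mult_nonneg_nonneg) auto
  have "(\<Sum>i\<in>S. (a i / A) *\<^sub>R T i) ^ \<nu> \<le> (\<Sum>i\<in>S. (a i / A) * T i ^ \<nu>)"
  proof (rule convex_on_sum[OF S S0 convex_on_power_nonneg])
    show "(\<Sum>i\<in>S. a i / A) = 1" using A0 by (simp add: A_def flip: sum_divide_distrib)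
  qed (use a T A0 in auto)
  also have "(\<Sum>i\<in>S. (a i / A) *\<^sub>R T i) = R / A"
    by (simp add: R_def sum_divide_distrib)
  also have "(\<Sum>i\<in>S. (a i / A) * T i ^ \<nu>) = (\<Sum>i\<in>S. a i * T i ^ \<nu>) / A"
    by (simp add: sum_divide_distrib)
  finally have "R ^ \<nu> / A ^ \<nu> \<le> (\<Sum>i\<in>S. a i * T i ^ \<nu>) / A"
    by (simp add: power_divide)
  then have "R ^ \<nu> \<le> (\<Sum>i\<in>S. a i * T i ^ \<nu>) / A * A ^ \<nu>"
    using A0 by (simp only: pos_divide_le_eq zero_less_power)
  also have "\<dots> = A ^ (\<nu> - 1) * (\<Sum>i\<in>S. a i * T i ^ \<nu>)"
    using A0 nu by (cases \<nu>) auto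
  also have "(\<Sum>i\<in>S. a i * T i ^ \<nu>) \<le> B * sqrt M"
  proof -
    have "(\<Sum>i\<in>S. a i * T i ^ \<nu>)\<^sup>2 \<le> (\<Sum>i\<in>S. (a i)\<^sup>2) * (\<Sum>i\<in>S. (T i ^ \<nu>)\<^sup>2)"
      by (rule Cauchy_Schwarz_ineq_sum)
    then have "(\<Sum>i\<in>S. a i * T i ^ \<nu>) \<le> sqrt ((\<Sum>i\<in>S. (a i)\<^sup>2) * (\<Sum>i\<in>S. (T i ^ \<nu>)\<^sup>2))"
      by (rule real_le_rsqrt)
    then show ?thesis
      unfolding B_def M_def by (simp add: real_sqrt_mult mult.commute flip: power_mult)
  qed
  finally have *: "R ^ \<nu> \<le> A ^ (\<nu> - 1) * (B * sqrt M)" using A0 by (simp add: mult_left_mono)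
  have "R = (R ^ \<nu>) powr (1 / real \<nu>)"
    using R0 nu by (cases "R = 0") (auto simp: powr_powr simp flip: powr_realpow)
  also have "\<dots> \<le> (A ^ (\<nu> - 1) * (B * sqrt M)) powr (1 / real \<nu>)"
    using * R0 by (intro powr_mono2) auto
  also have "\<dots> = (A powr real (\<nu> - 1)) powr (1 / real \<nu>) * B powr (1 / real \<nu>) * (M powr (1 / 2)) powr (1 / real \<nu>)"
    using A0 B0 M0 by (simp add: powr_mult powr_realpow powr_half_sqrt)
  also have "\<dots> = A powr (1 - 1 / real \<nu>) * B powr (1 / real \<nu>) * M powr (1 / (2 * real \<nu>))"
  proof -
    have "real (\<nu> - 1) * (1 / real \<nu>) = 1 - 1 / real \<nu>" using nu by (simp add: of_nat_diff field_simps)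
    then show ?thesis by (simp add: powr_powr)
  qed
  finally show ?thesis unfolding A_def B_def M_def R_def .
qed

section \<open>Additive characters modulo \<open>q\<close>: orthogonality, even moments, geometric
  sums\<close>

definition unit_char :: "int \<Rightarrow> int \<Rightarrow> complex" where
  "unit_char q n = exp (2 * complex_of_real pi * \<i> * of_int n / of_int q)"

lemma unit_char_add: "unit_char q (m + n) = unit_char q m * unit_char q n"
  by (simp add: unit_char_def ring_distribs add_divide_distrib exp_add)

lemma unit_char_0 [simp]: "unit_char q 0 = 1"
  by (simp add: unit_char_def)

lemma unit_char_mult_nat: "unit_char q (int m * n) = unit_char q n ^ m"
  by (induction m) (simp_all add: ring_distribs unit_char_add)

lemma unit_char_sum: "finite S \<Longrightarrow> unit_char q (\<Sum>i\<in>S. f i) = (\<Prod>i\<in>S. unit_char q (f i))"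
  by (induction S rule: finite_induct) (simp_all add: unit_char_add)

text \<open>With the exponent written as \<i> times a real number, the known facts on norm,
  conjugate and period of \<open>exp\<close> apply directly.\<close>

lemma unit_char_alt: "unit_char q n = exp (\<i> * complex_of_real (2 * pi * of_int n / of_int q))"
  by (simp add: unit_char_def mult_ac)

lemma norm_unit_char [simp]: "cmod (unit_char q n) = 1"
  by (simp add: unit_char_alt)

lemma cnj_unit_char: "cnj (unit_char q n) = unit_char q (- n)"
  by (simp add: unit_char_alt exp_cnj)

lemma unit_char_eq_1_iff:
  assumes "q \<noteq> 0"
  shows "unit_char q n = 1 \<longleftrightarrow> q dvd n"
proof -
  have "unit_char q n = 1 \<longleftrightarrow> (\<exists>j::int. 2 * pi * of_int n / of_int q = of_int (2 * j) * pi)"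
    unfolding unit_char_alt exp_eq_1 by simp
  also have "\<dots> \<longleftrightarrow> (\<exists>j::int. real_of_int n = real_of_int (q * j))"
    using assms by (intro ex_cong1) (simp add: field_simps)
  also have "\<dots> \<longleftrightarrow> q dvd n" unfolding of_int_eq_iff dvd_def ..
  finally show ?thesis .
qed

lemma unit_char_cong:
  assumes "q \<noteq> 0" "[m = n] (mod q)"
  shows "unit_char q m = unit_char q n"
proof -
  have "unit_char q (m - n) = 1"
    using assms by (simp add: unit_char_eq_1_iff cong_iff_dvd_diff)
  then show ?thesis using unit_char_add[of q "m - n" n] by simp
qed

text \<open>Orthogonality: a full geometric series whose ratio is a \<open>q\<close>-th root of
  unity, equal to 1 exactly when \<open>q dvd n\<close>.\<close>

lemma sum_unit_char:
  assumes "q > 0"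
  shows "(\<Sum>m\<in>{0..<q}. unit_char q (m * n)) = (if q dvd n then of_int q else 0)"
proof -
  have "(\<Sum>m\<in>{0..<q}. unit_char q (m * n)) = (\<Sum>m<nat q. unit_char q n ^ m)"
    by (rule sum.reindex_bij_witness[of _ int nat])
      (use assms in \<open>auto simp flip: unit_char_mult_nat\<close>)
  also have "\<dots> = (if q dvd n then of_int q else 0)"
  proof (cases "q dvd n")
    case True
    then have "unit_char q n = 1" using assms by (simp add: unit_char_eq_1_iff)
    then show ?thesis using True assms by simp
  next
    case False
    have "unit_char q n ^ nat q = unit_char q (q * n)"
      using assms by (simp flip: unit_char_mult_nat)
    also have "\<dots> = 1" using assms by (simp add: unit_char_eq_1_iff)
    finally show ?thesis
      using False assms by (simp add: geometric_sum unit_char_eq_1_iff)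
  qed
  finally show ?thesis .
qed

text \<open>Expanding the even power gives a sum over \<open>2 * \<nu>\<close>-tuples. Orthogonality
  in \<open>m\<close> keeps those whose signed sum is divisible by \<open>q\<close>, and each of
  these has a coefficient of modulus at most \<open>G ^ (2 * \<nu>)\<close>.\<close>

lemma even_moment_le:
  fixes g :: "'a \<Rightarrow> complex" and f :: "'a \<Rightarrow> int" and G :: real
  assumes q: "q > 0" and A: "finite A" and G: "\<And>y. y \<in> A \<Longrightarrow> cmod (g y) \<le> G"
  shows "(\<Sum>m\<in>{0..<q}. cmod (\<Sum>y\<in>A. g y * unit_char q (m * f y)) ^ (2 * \<nu>))
    \<le> of_int q * G ^ (2 * \<nu>) * real (card {z \<in> {..<2 * \<nu>} \<rightarrow>\<^sub>E A.
          q dvd (\<Sum>i<2 * \<nu>. (if i < \<nu> then 1 else -1) * f (z i))})"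
proof -
  define s :: "nat \<Rightarrow> int" where "s i = (if i < \<nu> then 1 else -1)" for i
  define Z where "Z = {..<2 * \<nu>} \<rightarrow>\<^sub>E A"
  define F where "F z = (\<Sum>i<2 * \<nu>. s i * f (z i))" for z
  define g' where "g' i y = (if i < \<nu> then g y else cnj (g y))" for i y
  define c where "c z = (\<Prod>i<2 * \<nu>. g' i (z i))" for z
  have finZ: "finite Z" unfolding Z_def using A by (intro finite_PiE) auto
  have expand: "complex_of_real (cmod (\<Sum>y\<in>A. g y * unit_char q (m * f y)) ^ (2 * \<nu>))
      = (\<Sum>z\<in>Z. c z * unit_char q (m * F z))" for m
  proof -
    let ?T = "\<Sum>y\<in>A. g y * unit_char q (m * f y)"
    have "complex_of_real (cmod ?T ^ (2 * \<nu>)) = complex_of_real ((cmod ?T)\<^sup>2) ^ \<nu>"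
      by (simp only: power_mult of_real_power)
    also have "\<dots> = ?T ^ \<nu> * cnj ?T ^ \<nu>"
      by (simp only: complex_norm_square power_mult_distrib)
    \<comment> \<open>The first \<nu> factors are the sum itself, the others its conjugate;
      conjugation negates the argument of the character, which produces the signs
      \<open>s\<close>.\<close>
    also have "\<dots> = (\<Prod>i<2 * \<nu>. if i < \<nu> then ?T else cnj ?T)"
    proof -
      have "{..<2 * \<nu>} \<inter> {i. i < \<nu>} = {..<\<nu>}" "{..<2 * \<nu>} \<inter> - {i. i < \<nu>} = {\<nu>..<2 * \<nu>}" by auto
      then show ?thesis by (simp add: prod.If_cases)
    qed
    also have "\<dots> = (\<Prod>i<2 * \<nu>. \<Sum>y\<in>A. g' i y * unit_char q (m * (s i * f y)))"
      by (intro prod.cong refl) (auto simp: g'_def s_def cnj_unit_char)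
    also have "\<dots> = (\<Sum>z\<in>Z. \<Prod>i<2 * \<nu>. g' i (z i) * unit_char q (m * (s i * f (z i))))"
      unfolding Z_def by (rule prod_sum_PiE) (use A in auto)
    also have "\<dots> = (\<Sum>z\<in>Z. c z * unit_char q (m * F z))"
      by (simp add: prod.distrib c_def F_def sum_distrib_left unit_char_sum)
    finally show ?thesis .
  qed
  have c: "cmod (c z) \<le> G ^ (2 * \<nu>)" if "z \<in> Z" for z
  proof -
    have "cmod (c z) = (\<Prod>i<2 * \<nu>. cmod (g' i (z i)))" by (simp add: c_def prod_norm)
    also have "\<dots> \<le> (\<Prod>i<2 * \<nu>. G)"
      by (intro prod_mono) (use that G in \<open>auto simp: Z_def g'_def\<close>)
    finally show ?thesis by simp
  qed
  define S where "S = (\<Sum>m\<in>{0..<q}. cmod (\<Sum>y\<in>A. g y * unit_char q (m * f y)) ^ (2 * \<nu>))"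
  have "complex_of_real S = (\<Sum>m\<in>{0..<q}. \<Sum>z\<in>Z. c z * unit_char q (m * F z))"
    unfolding S_def of_real_sum expand ..
  also have "\<dots> = (\<Sum>z\<in>Z. c z * (if q dvd F z then of_int q else 0))"
    by (subst sum.swap) (simp only: sum_unit_char[OF q] flip: sum_distrib_left)
  also have "\<dots> = (\<Sum>z\<in>{z \<in> Z. q dvd F z}. c z * of_int q)"
    using finZ by (simp add: sum.inter_filter if_distrib cong: if_cong)
  finally have S: "complex_of_real S = (\<Sum>z\<in>{z \<in> Z. q dvd F z}. c z * of_int q)" .
  have "S \<le> cmod (complex_of_real S)" by simp
  also have "\<dots> \<le> (\<Sum>z\<in>{z \<in> Z. q dvd F z}. G ^ (2 * \<nu>) * of_int q)"
    unfolding S using q c by (intro sum_norm_le) (auto simp: norm_mult intro!: mult_right_mono)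
  also have "\<dots> = of_int q * G ^ (2 * \<nu>) * real (card {z \<in> Z. q dvd F z})" by simp
  finally show ?thesis unfolding S_def Z_def F_def s_def .
qed

text \<open>Jordan's inequality with half the optimal constant. Up to \<pi>/6 the derivative of
  \<open>sin t - t / 2\<close> is nonnegative; beyond, \<open>sin x \<ge> 1 / 2\<close> while
  \<open>x / pi \<le> 1 / 2\<close>.\<close>

lemma sin_ge_div_pi:
  fixes x :: real
  assumes "0 \<le> x" "x \<le> pi / 2"
  shows "x / pi \<le> sin x"
proof (cases "x \<le> pi / 6")
  case True
  have "sin 0 - 0 / 2 \<le> sin x - x / 2"
  proof (rule DERIV_nonneg_imp_nondecreasing[OF assms(1)])
    fix t assume t: "0 \<le> t" "t \<le> x"
    have "cos (pi / 3) \<le> cos t" using t True by (intro cos_monotone_0_pi_le) auto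
    then have "0 \<le> cos t - 1 / 2" by (simp add: cos_60)
    moreover have "((\<lambda>t. sin t - t / 2) has_real_derivative cos t - 1 / 2) (at t)"
      by (auto intro!: derivative_eq_intros)
    ultimately show "\<exists>y. ((\<lambda>t. sin t - t / 2) has_real_derivative y) (at t) \<and> 0 \<le> y" by blast
  qed
  moreover have "x / pi \<le> x / 2" using assms pi_ge_two by (intro divide_left_mono) auto
  ultimately show ?thesis unfolding sin_zero by linarith
next
  case False
  have "sin (pi / 6) \<le> sin x" using False assms by (intro sin_monotone_2pi_le) auto
  moreover have "x / pi \<le> 1 / 2" using assms by (simp add: field_simps)
  ultimately show ?thesis unfolding sin_30 by linarith
qed

text \<open>The chord from 1 to the point at angle 2\<pi>y/q has length 2 sin(\<pi>y/q), and
  \<open>2 * y \<le> q\<close> keeps \<pi>y/q within the first quadrant.\<close>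

lemma norm_unit_char_minus_1_ge:
  fixes y q :: int
  assumes "0 < y" "2 * y \<le> q"
  shows "2 * of_int y / of_int q \<le> cmod (unit_char q y - 1)"
proof -
  have "of_int y / of_int q \<le> (1 / 2 :: real)"
    using assms by (simp add: field_simps)
  then have "pi * (of_int y / of_int q) \<le> pi * (1 / 2 :: real)"
    by (intro mult_left_mono) auto
  then have "(pi * of_int y / of_int q) / pi \<le> sin (pi * of_int y / of_int q)"
    using assms by (intro sin_ge_div_pi) auto
  moreover have "cmod (unit_char q y - 1) = 2 * \<bar>sin (pi * of_int y / of_int q)\<bar>"
    unfolding unit_char_alt dist_exp_i_1 by simp
  ultimately show ?thesis by simp
qed

text \<open>The triangle inequality gives \<open>N\<close>. Summing the geometric series with ratio
  \<open>w\<close> gives 2/|w - 1|, and the chord bound turns this into q/y; the sign -1 merely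
  conjugates the ratio.\<close>

lemma norm_sum_unit_char_interval_le:
  fixes y q L :: int and N :: nat
  assumes "0 < y" "2 * y \<le> q" "\<sigma> = 1 \<or> \<sigma> = -1"
  shows "cmod (\<Sum>j\<in>{L + 1..L + int N}. unit_char q (j * (\<sigma> * y))) \<le> min (real N) (of_int q / of_int y)"
proof -
  have "cmod (\<Sum>j\<in>{L + 1..L + int N}. unit_char q (j * (\<sigma> * y))) \<le> (\<Sum>j\<in>{L + 1..L + int N}. 1)"
    by (intro sum_norm_le) simp
  then have 1: "cmod (\<Sum>j\<in>{L + 1..L + int N}. unit_char q (j * (\<sigma> * y))) \<le> real N" by simp
  have eq: "(\<Sum>j\<in>{L + 1..L + int N}. unit_char q (j * (\<sigma> * y)))
      = unit_char q ((L + 1) * (\<sigma> * y)) * (\<Sum>j<N. unit_char q (\<sigma> * y) ^ j)"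
    unfolding sum_distrib_left
    by (rule sum.reindex_bij_witness[of _ "\<lambda>j. L + 1 + int j" "\<lambda>j. nat (j - L - 1)"])
      (auto simp: algebra_simps simp flip: unit_char_mult_nat unit_char_add)
  define w where "w = unit_char q (\<sigma> * y)"
  have w: "2 * of_int y / of_int q \<le> cmod (w - 1)"
  proof (cases "\<sigma> = 1")
    case True
    then show ?thesis using norm_unit_char_minus_1_ge[OF assms(1,2)] by (simp add: w_def)
  next
    case False
    then have "w - 1 = cnj (unit_char q y - 1)" using assms(3) by (simp add: w_def cnj_unit_char)
    then show ?thesis using norm_unit_char_minus_1_ge[OF assms(1,2)] by (simp only: complex_mod_cnj)
  qed
  have "(w - 1) * (\<Sum>j<N. w ^ j) = w ^ N - 1" by (simp add: power_diff_1_eq)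
  then have "cmod (w - 1) * cmod (\<Sum>j<N. w ^ j) = cmod (w ^ N - 1)" by (simp flip: norm_mult)
  also have "\<dots> \<le> cmod (w ^ N) + cmod 1" by (rule norm_triangle_ineq4)
  also have "\<dots> = 2" by (simp add: w_def norm_power)
  finally have "2 * of_int y / of_int q * cmod (\<Sum>j<N. w ^ j) \<le> 2"
    using mult_right_mono[OF w, of "cmod (\<Sum>j<N. w ^ j)"] by simp
  then have "cmod (\<Sum>j<N. w ^ j) \<le> of_int q / of_int y"
    using assms by (simp add: field_simps)
  then show ?thesis using 1 unfolding eq w_def by (simp add: norm_mult)
qed

text \<open>At most \<open>q\<close> consecutive integers are pairwise incongruent, so reduction
  modulo \<open>q\<close> merges no terms.\<close>

lemma sum_residue_interval:
  assumes q: "q > 0" and N: "int N \<le> q"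
  shows "(\<Sum>n\<in>residue_interval q L N. unit_char q (n * y)) = (\<Sum>j\<in>{L + 1..L + int N}. unit_char q (j * y))"
proof -
  have "inj_on (\<lambda>j. j mod q) {L + 1..L + int N}"
  proof (rule inj_onI)
    fix i j assume ij: "i \<in> {L + 1..L + int N}" "j \<in> {L + 1..L + int N}" "i mod q = j mod q"
    then have "q dvd i - j" by (simp add: mod_eq_dvd_iff)
    moreover have "\<bar>i - j\<bar> < q" using ij N by auto
    ultimately show "i = j" using zdvd_imp_le[of q "\<bar>i - j\<bar>"] by (cases "i = j") auto
  qed
  then have "(\<Sum>n\<in>residue_interval q L N. unit_char q (n * y))
      = (\<Sum>j\<in>{L + 1..L + int N}. unit_char q (j mod q * y))"
    unfolding residue_interval_def by (simp add: sum.reindex)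
  also have "\<dots> = (\<Sum>j\<in>{L + 1..L + int N}. unit_char q (j * y))"
    using q by (intro sum.cong refl unit_char_cong cong_scalar_right) (auto simp: cong_def)
  finally show ?thesis .
qed

section \<open>The bilinear form\<close>

text \<open>Clearing denominators: the full product times the inverse of \<open>z i\<close> is the
  product of the other variables. The sign \<sigma> enters the prefactor and every inverse, and
  cancels as \<sigma>\<sigma> = 1; so one count of solutions serves the residues y and -y.\<close>

lemma inverse_form_cong:
  fixes z :: "nat \<Rightarrow> int"
  assumes cop: "\<And>i. i < 2 * \<nu> \<Longrightarrow> coprime (z i) q" and \<sigma>: "\<sigma> * \<sigma> = (1::int)"
  shows "[inverse_form k \<nu> z = (\<sigma> * (\<Prod>j<2 * \<nu>. z j)) ^ k *
      (\<Sum>i<2 * \<nu>. (if i < \<nu> then 1 else -1) * (\<sigma> * modular_inverse q (z i)) ^ k)] (mod q)"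
proof -
  let ?P = "\<Prod>j<2 * \<nu>. z j" and ?s = "\<lambda>i. (if i < \<nu> then 1 else -1) :: int"
  have "[inverse_form k \<nu> z = (\<Sum>i<2 * \<nu>. ?s i * (\<sigma> * ?P * (\<sigma> * modular_inverse q (z i))) ^ k)] (mod q)"
    unfolding inverse_form_def
  proof (intro cong_sum cong_mult cong_refl cong_pow)
    fix i assume i: "i \<in> {..<2 * \<nu>}"
    let ?R = "\<Prod>j\<in>{..<2 * \<nu>} - {i}. z j"
    have P: "?P = z i * ?R" using i by (intro prod.remove) auto
    have "\<sigma> * ?P * (\<sigma> * modular_inverse q (z i)) = (\<sigma> * \<sigma>) * (?R * (z i * modular_inverse q (z i)))"
      unfolding P by (simp only: mult_ac)
    also have "[\<dots> = 1 * (?R * 1)] (mod q)"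
      unfolding \<sigma> using i by (intro cong_mult cong_refl cong_modular_inverse1 cop) auto
    finally show "[?R = \<sigma> * ?P * (\<sigma> * modular_inverse q (z i))] (mod q)"
      by (simp add: cong_sym)
  qed
  also have "(\<Sum>i<2 * \<nu>. ?s i * (\<sigma> * ?P * (\<sigma> * modular_inverse q (z i))) ^ k)
      = (\<sigma> * ?P) ^ k * (\<Sum>i<2 * \<nu>. ?s i * (\<sigma> * modular_inverse q (z i)) ^ k)"
    unfolding sum_distrib_left
    by (intro sum.cong refl) (simp only: power_mult_distrib mult_ac)
  finally show ?thesis .
qed

text \<open>Hoelder's inequality splits off the weights, and the even moment of the inner sums
  counts tuples from \<open>A\<close> with a congruence between inverse powers. After clearing
  denominators these are among the \<open>inverse_solutions\<close> with variables up to
  \<open>X\<close>.\<close>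

lemma block_sum_le:
  fixes g \<alpha> :: "int \<Rightarrow> complex" and G :: real
  assumes q: "q > 0" and nu: "\<nu> > 0" and \<sigma>: "\<sigma> * \<sigma> = (1::int)"
    and A: "\<And>y. y \<in> A \<Longrightarrow> 1 \<le> y \<and> y \<le> int X \<and> coprime y q"
    and G: "\<And>y. y \<in> A \<Longrightarrow> cmod (g y) \<le> G"
  shows "cmod (\<Sum>m\<in>{0..<q}. \<alpha> m * (\<Sum>y\<in>A. g y * unit_char q (m * (\<sigma> * modular_inverse q y) ^ k)))
    \<le> weights_norm1 q \<alpha> powr (1 - 1 / real \<nu>) * weights_norm2 q \<alpha> powr (1 / real \<nu>)
      * (of_int q * G ^ (2 * \<nu>) * real (card (inverse_solutions k \<nu> q X))) powr (1 / (2 * real \<nu>))"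
proof -
  let ?T = "\<lambda>m. \<Sum>y\<in>A. g y * unit_char q (m * (\<sigma> * modular_inverse q y) ^ k)"
  have finA: "finite A" by (rule finite_subset[of _ "{1..int X}"]) (use A in auto)
  let ?Z = "{z \<in> {..<2 * \<nu>} \<rightarrow>\<^sub>E A.
      q dvd (\<Sum>i<2 * \<nu>. (if i < \<nu> then 1 else -1) * (\<sigma> * modular_inverse q (z i)) ^ k)}"
  have "?Z \<subseteq> inverse_solutions k \<nu> q X"
  proof
    fix z assume z: "z \<in> ?Z"
    then have zP: "z \<in> {..<2 * \<nu>} \<rightarrow>\<^sub>E A"
      and dvd: "q dvd (\<Sum>i<2 * \<nu>. (if i < \<nu> then 1 else -1) * (\<sigma> * modular_inverse q (z i)) ^ k)"
      by simp_all
    have zA: "z i \<in> A" if "i < 2 * \<nu>" for i using zP that by (auto simp: PiE_def Pi_def)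
    have cong: "[inverse_form k \<nu> z = (\<sigma> * (\<Prod>j<2 * \<nu>. z j)) ^ k *
      (\<Sum>i<2 * \<nu>. (if i < \<nu> then 1 else -1) * (\<sigma> * modular_inverse q (z i)) ^ k)] (mod q)"
      using A zA by (intro inverse_form_cong \<sigma>) auto
    have "q dvd inverse_form k \<nu> z"
      unfolding cong_dvd_iff[OF cong] by (rule dvd_mult[OF dvd])
    moreover have "z \<in> {..<2 * \<nu>} \<rightarrow>\<^sub>E {1..int X}"
      using A by (intro subsetD[OF PiE_mono zP]) auto
    ultimately show "z \<in> inverse_solutions k \<nu> q X"
      unfolding inverse_solutions_def by blast
  qed
  then have card: "card ?Z \<le> card (inverse_solutions k \<nu> q X)"
    by (intro card_mono) auto
  have "cmod (\<Sum>m\<in>{0..<q}. \<alpha> m * ?T m) \<le> (\<Sum>m\<in>{0..<q}. cmod (\<alpha> m) * cmod (?T m))"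
    by (intro sum_norm_le) (simp add: norm_mult)
  also have "\<dots> \<le> weights_norm1 q \<alpha> powr (1 - 1 / real \<nu>) * weights_norm2 q \<alpha> powr (1 / real \<nu>)
      * (\<Sum>m\<in>{0..<q}. cmod (?T m) ^ (2 * \<nu>)) powr (1 / (2 * real \<nu>))"
    unfolding weights_norm1_def weights_norm2_def
    by (rule holder_sum_le) (use nu in auto)
  also have "\<dots> \<le> weights_norm1 q \<alpha> powr (1 - 1 / real \<nu>) * weights_norm2 q \<alpha> powr (1 / real \<nu>)
      * (of_int q * G ^ (2 * \<nu>) * real (card (inverse_solutions k \<nu> q X))) powr (1 / (2 * real \<nu>))"
  proof (intro mult_left_mono powr_mono2)
    have "(\<Sum>m\<in>{0..<q}. cmod (?T m) ^ (2 * \<nu>)) \<le> of_int q * G ^ (2 * \<nu>) * real (card ?Z)"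
      by (rule even_moment_le[OF q finA]) (rule G)
    also have "\<dots> \<le> of_int q * G ^ (2 * \<nu>) * real (card (inverse_solutions k \<nu> q X))"
      using card q by (intro mult_left_mono) auto
    finally show "(\<Sum>m\<in>{0..<q}. cmod (?T m) ^ (2 * \<nu>))
      \<le> of_int q * G ^ (2 * \<nu>) * real (card (inverse_solutions k \<nu> q X))" .
  qed (auto intro!: sum_nonneg)
  finally show ?thesis .
qed

section \<open>Rearranging the form over absolutely least residues and adding up dyadic
  blocks\<close>

lemma modular_inverse_modular_inverse:
  fixes q x :: int
  assumes "x \<in> {0..<q}" "coprime x q"
  shows "modular_inverse q (modular_inverse q x) = x"
  using assms by (intro modular_inverse_int_eqI cong_modular_inverse2)

lemma modular_inverse_in_residue_units:
  assumes "x \<in> residue_units q"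
  shows "modular_inverse q x \<in> residue_units q"
  using assms
  by (auto simp: residue_units_def modular_inverse_int_nonneg modular_inverse_int_less)

lemma modular_inverse_diff:
  fixes q y :: int
  assumes "q > 1" "coprime y q"
  shows "modular_inverse q (q - y) = q - modular_inverse q y"
proof (rule modular_inverse_int_eqI)
  show "q - modular_inverse q y \<in> {0..<q}"
    using assms modular_inverse_int_less[of q y] mult_modular_inverse_int_pos[of q y] by auto
  have "(q - y) * (q - modular_inverse q y) = y * modular_inverse q y + q * (q - y - modular_inverse q y)"
    by (simp add: algebra_simps)
  also have "[\<dots> = 1 + 0] (mod q)"
    using assms by (intro cong_add cong_modular_inverse1) (auto simp: cong_def)
  finally show "[(q - y) * (q - modular_inverse q y) = 1] (mod q)" by simp
qed

definition interval_char_sum :: "int \<Rightarrow> int set \<Rightarrow> int \<Rightarrow> complex" where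
  "interval_char_sum q J y = (\<Sum>n\<in>J. unit_char q (n * y))"

text \<open>Inversion is an involution of the units. Substituting it moves the inverse to the
  \<open>k\<close>-th power and leaves \<open>n\<close> multiplied by the variable itself, so that
  the sum over an interval becomes geometric.\<close>

lemma kloosterman_form_eq:
  "kloosterman_form k q \<alpha> J = (\<Sum>m\<in>{0..<q}. \<alpha> m *
     (\<Sum>y\<in>residue_units q. interval_char_sum q J y * unit_char q (m * modular_inverse q y ^ k)))"
  unfolding kloosterman_form_def
proof (intro sum.cong refl)
  fix m
  have e: "exp (2 * complex_of_real pi * \<i> * of_int (m * x ^ k + n * modular_inverse q x) / of_int q)
      = unit_char q (n * modular_inverse q x) * unit_char q (m * x ^ k)" for n x
    unfolding unit_char_def[symmetric] unit_char_add by (rule mult.commute)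
  have "(\<Sum>n\<in>J. \<alpha> m * (\<Sum>x\<in>residue_units q.
           exp (2 * complex_of_real pi * \<i> * of_int (m * x ^ k + n * modular_inverse q x) / of_int q)))
      = \<alpha> m * (\<Sum>n\<in>J. \<Sum>x\<in>residue_units q. unit_char q (n * modular_inverse q x) * unit_char q (m * x ^ k))"
    by (simp only: e sum_distrib_left)
  also have "\<dots> = \<alpha> m * (\<Sum>x\<in>residue_units q. interval_char_sum q J (modular_inverse q x) * unit_char q (m * x ^ k))"
    by (subst sum.swap) (simp only: interval_char_sum_def sum_distrib_right)
  also have "(\<Sum>x\<in>residue_units q. interval_char_sum q J (modular_inverse q x) * unit_char q (m * x ^ k))
      = (\<Sum>y\<in>residue_units q. interval_char_sum q J y * unit_char q (m * modular_inverse q y ^ k))"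
    by (rule sum.reindex_bij_witness[of _ "modular_inverse q" "modular_inverse q"])
      (auto simp: modular_inverse_in_residue_units, auto simp: residue_units_def modular_inverse_modular_inverse)
  finally show "(\<Sum>n\<in>J. \<alpha> m * (\<Sum>x\<in>residue_units q.
           exp (2 * complex_of_real pi * \<i> * of_int (m * x ^ k + n * modular_inverse q x) / of_int q)))
      = \<alpha> m * (\<Sum>y\<in>residue_units q. interval_char_sum q J y * unit_char q (m * modular_inverse q y ^ k))" .
qed

lemma coprime_modulus_diff:
  fixes q y :: int
  assumes "coprime y q"
  shows "coprime (q - y) q"
  using assms cong_imp_coprime[of "- y" "q - y" q] by (simp add: cong_iff_dvd_diff)

text \<open>\<open>\<sigma> = 1\<close> and \<open>\<sigma> = -1\<close> encode the residues \<open>y\<close> and \<open>q - y\<close> respectively; the strict inequality in the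
  second case keeps \<open>y = q / 2\<close> from being counted twice.\<close>
definition half_units :: "int \<Rightarrow> int \<Rightarrow> int set" where
  "half_units q \<sigma> = {y \<in> residue_units q. if \<sigma> = 1 then 2 * y \<le> q else 2 * y < q}"

text \<open>Units above q/2 are replaced by \<open>q - y\<close>, which is congruent to -y; the sign
  passes into the interval sum and into the inverse.\<close>

lemma sum_residue_units_split:
  assumes q: "q > 1"
  shows "(\<Sum>y\<in>residue_units q. interval_char_sum q J y * unit_char q (m * modular_inverse q y ^ k))
    = (\<Sum>\<sigma>\<in>{1, -1}. \<Sum>y\<in>half_units q \<sigma>.
        interval_char_sum q J (\<sigma> * y) * unit_char q (m * (\<sigma> * modular_inverse q y) ^ k))"
proof -
  let ?h = "\<lambda>y. interval_char_sum q J y * unit_char q (m * modular_inverse q y ^ k)"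
  let ?H = "{y \<in> residue_units q. \<not> 2 * y \<le> q}"
  have fin: "finite (residue_units q)"
    by (rule finite_subset[of _ "{0..<q}"]) (auto simp: residue_units_def)
  have "(\<Sum>y\<in>residue_units q. ?h y) = (\<Sum>y\<in>half_units q 1. ?h y) + (\<Sum>y\<in>?H. ?h y)"
    using fin by (subst sum.union_disjoint[symmetric]) (auto simp: half_units_def intro!: sum.cong)
  also have "(\<Sum>y\<in>?H. ?h y) = (\<Sum>y\<in>half_units q (-1). interval_char_sum q J (- y) * unit_char q (m * (- modular_inverse q y) ^ k))"
  proof (rule sum.reindex_bij_witness[of _ "\<lambda>y. q - y" "\<lambda>y. q - y"])
    fix y assume y: "y \<in> ?H"
    then show "q - (q - y) = y" by simp
    show "q - y \<in> half_units q (-1)"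
      using y by (auto simp: half_units_def residue_units_def coprime_modulus_diff)
    have cop: "coprime y q" using y by (simp add: residue_units_def)
    have "unit_char q (n * - (q - y)) = unit_char q (n * y)" for n
      using q by (intro unit_char_cong) (auto simp: cong_iff_dvd_diff algebra_simps)
    moreover have "- modular_inverse q (q - y) = modular_inverse q y - q"
      using modular_inverse_diff[OF q cop] by simp
    moreover have "unit_char q (m * (modular_inverse q y - q) ^ k) = unit_char q (m * modular_inverse q y ^ k)"
      using q by (intro unit_char_cong cong_mult cong_pow cong_refl) (auto simp: cong_iff_dvd_diff)
    ultimately show "interval_char_sum q J (- (q - y)) * unit_char q (m * (- modular_inverse q (q - y)) ^ k) = ?h y"
      by (simp only: interval_char_sum_def)
  next
    fix y assume y: "y \<in> half_units q (-1)"
    then show "q - (q - y) = y" by simp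
    \<comment> \<open>For \<open>y = 0\<close> the reflected value \<open>q\<close> would leave the
      range of representatives; \<open>q > 1\<close> prevents 0 from being a unit.\<close>
    have "y \<noteq> 0"
    proof
      assume "y = 0"
      then show False using y q by (auto simp: half_units_def residue_units_def)
    qed
    then show "q - y \<in> ?H"
      using y by (auto simp: half_units_def residue_units_def coprime_modulus_diff)
  qed
  finally show ?thesis by simp
qed

text \<open>The two parts of the solution count yield the two terms of the target:
  \<open>G\<^sup>2 * X \<le> 2 * N * q\<close> turns the diagonal part X^\<nu> into the term with
  \<open>N\<close>, and \<open>G * X \<le> 2 * q\<close> turns the part X^(2\<nu>)/q into
  \<open>q\<close>.\<close>

lemma block_weight_le:
  fixes q N X G E c :: real
  assumes nu: "\<nu> > 0" and q: "q > 0" and N: "N \<ge> 0" and G: "G \<ge> 0" and X: "X \<ge> 0" and E: "E \<ge> 0"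
    and GX: "G * X \<le> 2 * q" "G\<^sup>2 * X \<le> 2 * N * q"
    and c: "c \<le> (X ^ \<nu> + 2 * X ^ (2 * \<nu>) / q) * E" "c \<ge> 0"
  shows "(q * G ^ (2 * \<nu>) * c) powr (1 / (2 * real \<nu>))
    \<le> 4 * (q + q powr ((real \<nu> + 1) / (2 * real \<nu>)) * N powr (1 / 2)) * E powr (1 / (2 * real \<nu>))"
proof -
  define D where "D = q powr ((real \<nu> + 1) / (2 * real \<nu>)) * N powr (1 / 2)"
  have D0: "D \<ge> 0" by (simp add: D_def)
  have D: "D ^ (2 * \<nu>) = q * (N * q) ^ \<nu>"
  proof -
    have "(q powr ((real \<nu> + 1) / (2 * real \<nu>))) ^ (2 * \<nu>) = q powr ((real \<nu> + 1) / (2 * real \<nu>) * real (2 * \<nu>))"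
      using q by (simp only: powr_realpow[symmetric] powr_gt_zero powr_powr)
    also have "(real \<nu> + 1) / (2 * real \<nu>) * real (2 * \<nu>) = real (\<nu> + 1)" using nu by simp
    also have "q powr real (\<nu> + 1) = q ^ (\<nu> + 1)" using q by (rule powr_realpow)
    finally have 1: "(q powr ((real \<nu> + 1) / (2 * real \<nu>))) ^ (2 * \<nu>) = q ^ (\<nu> + 1)" .
    have 2: "(N powr (1 / 2)) ^ (2 * \<nu>) = N ^ \<nu>"
      using N by (simp add: powr_half_sqrt power_mult)
    show ?thesis unfolding D_def power_mult_distrib 1 2 by simp
  qed
  have pw: "(4::real) ^ (2 * \<nu>) = 4 ^ \<nu> * 4 ^ \<nu>" by (simp add: mult_2 power_add)
  \<comment> \<open>The constant 4 of the conclusion absorbs 2^\<nu> and 2 * 4^\<nu> into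
    4^(2\<nu>); the latter uses \<nu> > 0.\<close>
  have four: "(2::real) \<le> 4 ^ \<nu>" using nu self_le_power[of "4::real" \<nu>] by simp
  have "q * G ^ (2 * \<nu>) * c \<le> q * G ^ (2 * \<nu>) * ((X ^ \<nu> + 2 * X ^ (2 * \<nu>) / q) * E)"
    using c q G by (intro mult_left_mono) auto
  also have "\<dots> = (q * (G\<^sup>2 * X) ^ \<nu> + 2 * (G * X) ^ (2 * \<nu>)) * E"
  proof -
    have "(G\<^sup>2 * X) ^ \<nu> = G ^ (2 * \<nu>) * X ^ \<nu>" "(G * X) ^ (2 * \<nu>) = G ^ (2 * \<nu>) * X ^ (2 * \<nu>)"
      by (simp_all only: power_mult_distrib power_mult)
    then show ?thesis using q by (simp only:) (simp add: field_simps)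
  qed
  also have "\<dots> \<le> (q * (2 * N * q) ^ \<nu> + 2 * (2 * q) ^ (2 * \<nu>)) * E"
    using GX q G X E by (intro mult_right_mono add_mono mult_left_mono power_mono) auto
  also have "\<dots> = (2 ^ \<nu> * D ^ (2 * \<nu>) + 2 * 4 ^ \<nu> * q ^ (2 * \<nu>)) * E"
  proof -
    have "(2 * N * q) ^ \<nu> = 2 ^ \<nu> * (N * q) ^ \<nu>"
      by (simp only: power_mult_distrib mult.assoc)
    moreover have "(2 * q) ^ (2 * \<nu>) = 4 ^ \<nu> * q ^ (2 * \<nu>)"
      unfolding power_mult_distrib[of 2 q] power_mult[of 2 2] by simp
    ultimately show ?thesis unfolding D by (simp only:) simp
  qed
  also have "\<dots> \<le> (4 ^ (2 * \<nu>) * D ^ (2 * \<nu>) + 4 ^ (2 * \<nu>) * q ^ (2 * \<nu>)) * E"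
  proof (intro mult_right_mono add_mono)
    have "(2::real) ^ \<nu> \<le> 4 ^ \<nu>" by (intro power_mono) auto
    also have "\<dots> \<le> 4 ^ (2 * \<nu>)" by (intro power_increasing) auto
    finally show "(2::real) ^ \<nu> \<le> 4 ^ (2 * \<nu>)" .
    show "2 * (4::real) ^ \<nu> \<le> 4 ^ (2 * \<nu>)" unfolding pw using four by (intro mult_right_mono) auto
  qed (use D0 q E in auto)
  also have "\<dots> = 4 ^ (2 * \<nu>) * (D ^ (2 * \<nu>) + q ^ (2 * \<nu>)) * E" by (simp only: distrib_left)
  also have "\<dots> \<le> 4 ^ (2 * \<nu>) * (q + D) ^ (2 * \<nu>) * E"
  proof -
    \<comment> \<open>Superadditivity of powers on nonnegative numbers lets the
      \<open>2 * \<nu>\<close>-th root act on one power instead of a sum of two.\<close>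
    have "D ^ n + q ^ n \<le> (q + D) ^ n" if "n > 0" for n
      using that
    proof (induction n rule: nat_induct_non_zero)
      case (Suc n)
      have "D ^ Suc n + q ^ Suc n \<le> (q + D) * (D ^ n + q ^ n)"
        using D0 q by (simp add: algebra_simps)
      also have "\<dots> \<le> (q + D) * (q + D) ^ n" using Suc D0 q by (intro mult_left_mono) auto
      finally show ?case by simp
    qed simp
    then show ?thesis using nu E by (intro mult_right_mono mult_left_mono) auto
  qed
  also have "\<dots> = (4 * (q + D)) ^ (2 * \<nu>) * E" by (simp only: power_mult_distrib)
  finally have "(q * G ^ (2 * \<nu>) * c) powr (1 / (2 * real \<nu>)) \<le> ((4 * (q + D)) ^ (2 * \<nu>) * E) powr (1 / (2 * real \<nu>))"
    using q G c by (intro powr_mono2) auto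
  also have "\<dots> = ((4 * (q + D)) ^ (2 * \<nu>)) powr (1 / (2 * real \<nu>)) * E powr (1 / (2 * real \<nu>))"
    by (rule powr_mult)
  also have "((4 * (q + D)) ^ (2 * \<nu>)) powr (1 / (2 * real \<nu>)) = 4 * (q + D)"
  proof -
    have pos: "4 * (q + D) > 0" using q D0 by simp
    have "((4 * (q + D)) ^ (2 * \<nu>)) powr (1 / (2 * real \<nu>)) = (4 * (q + D)) powr (real (2 * \<nu>) * (1 / (2 * real \<nu>)))"
      by (simp only: powr_realpow[OF pos, symmetric] powr_powr)
    also have "real (2 * \<nu>) * (1 / (2 * real \<nu>)) = 1" using nu by simp
    finally show ?thesis using pos by simp
  qed
  finally show ?thesis unfolding D_def .
qed

text \<open>Two signs and the dyadic ranges 2^i \<le> y < 2^(i+1) cut the form into blocks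
  \<open>T \<sigma> i\<close>, all subject to the same bound \<open>R\<close>. \<open>E\<close> is
  the allowed excess of the solution counts over their expected order.\<close>

lemma kloosterman_form_le:
  fixes E :: real
  assumes q: "q > 1" and nu: "\<nu> > 0" and N: "int N \<le> q" and E: "E \<ge> 0"
    and sol: "\<And>i. 2 ^ i \<le> q \<Longrightarrow> real (card (inverse_solutions k \<nu> q (2 ^ i)))
       \<le> ((2 ^ i) ^ \<nu> + 2 * (2 ^ i) ^ (2 * \<nu>) / of_int q) * E"
  shows "cmod (kloosterman_form k q \<alpha> (residue_interval q L N))
    \<le> 2 * real (card {i::nat. 2 ^ i \<le> real_of_int q}) *
       (weights_norm1 q \<alpha> powr (1 - 1 / real \<nu>) * weights_norm2 q \<alpha> powr (1 / real \<nu>) *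
        (4 * (of_int q + of_int q powr ((real \<nu> + 1) / (2 * real \<nu>)) * real N powr (1 / 2)) * E powr (1 / (2 * real \<nu>))))"
proof -
  define J where "J = residue_interval q L N"
  define I where "I = {i::nat. 2 ^ i \<le> real_of_int q}"
  define \<gamma> where "\<gamma> \<sigma> y = interval_char_sum q J (\<sigma> * y)" for \<sigma> y
  define H where "H \<sigma> i = {y \<in> half_units q \<sigma>. floor_log (nat y) = i}" for \<sigma> i
  define T where "T \<sigma> i = (\<Sum>m\<in>{0..<q}. \<alpha> m *
      (\<Sum>y\<in>H \<sigma> i. \<gamma> \<sigma> y * unit_char q (m * (\<sigma> * modular_inverse q y) ^ k)))" for \<sigma> i
  define R where "R = weights_norm1 q \<alpha> powr (1 - 1 / real \<nu>) * weights_norm2 q \<alpha> powr (1 / real \<nu>) *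
        (4 * (of_int q + of_int q powr ((real \<nu> + 1) / (2 * real \<nu>)) * real N powr (1 / 2)) * E powr (1 / (2 * real \<nu>)))"
  have R0: "R \<ge> 0"
    unfolding R_def using q by (intro mult_nonneg_nonneg add_nonneg_nonneg) auto
  have finI: "finite I"
    unfolding I_def using card_powers_of_2_le[of 1] q by (metis less_le of_int_1_le_iff zero_less_one)
  have unit: "y \<ge> 1 \<and> 2 * y \<le> q \<and> coprime y q" if "y \<in> half_units q \<sigma>" for y \<sigma>
  proof -
    have "y \<noteq> 0" using that q by (auto simp: half_units_def residue_units_def)
    then show ?thesis using that by (auto simp: half_units_def residue_units_def split: if_splits)
  qed
  have fl: "2 ^ floor_log (nat y) \<le> y \<and> y < 2 * 2 ^ floor_log (nat y)" if "y \<ge> 1" for y :: int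
  proof -
    have "2 ^ floor_log (nat y) \<le> nat y" "nat y < 2 * 2 ^ floor_log (nat y)"
      using floor_log_exp2_le[of "nat y"] floor_log_exp2_gt[of "nat y"] that by auto
    then have "int (2 ^ floor_log (nat y)) \<le> int (nat y)" "int (nat y) < int (2 * 2 ^ floor_log (nat y))"
      by (simp_all only: of_nat_le_iff of_nat_less_iff)
    then show ?thesis using that by simp
  qed
  have fin: "finite (half_units q \<sigma>)" for \<sigma>
    by (rule finite_subset[of _ "{0..<q}"]) (auto simp: half_units_def residue_units_def)
  have sub: "(\<lambda>y. floor_log (nat y)) ` half_units q \<sigma> \<subseteq> I" for \<sigma>
  proof
    fix i assume "i \<in> (\<lambda>y. floor_log (nat y)) ` half_units q \<sigma>"
    then obtain y where y: "y \<in> half_units q \<sigma>" "i = floor_log (nat y)" by blast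
    then have "2 ^ i \<le> q" using unit[OF y(1)] fl[of y] by simp
    then have "real_of_int (2 ^ i) \<le> real_of_int q" by (simp only: of_int_le_iff)
    then show "i \<in> I" by (simp add: I_def)
  qed
  have "kloosterman_form k q \<alpha> J = (\<Sum>m\<in>{0..<q}. \<alpha> m * (\<Sum>\<sigma>\<in>{1, -1}. \<Sum>i\<in>I. \<Sum>y\<in>H \<sigma> i.
      \<gamma> \<sigma> y * unit_char q (m * (\<sigma> * modular_inverse q y) ^ k)))"
    unfolding kloosterman_form_eq sum_residue_units_split[OF q] \<gamma>_def H_def
    by (simp only: sum.group[OF fin finI sub])
  also have "\<dots> = (\<Sum>\<sigma>\<in>{1, -1}. \<Sum>i\<in>I. T \<sigma> i)"
    unfolding T_def sum_distrib_left
    by (subst sum.swap, intro sum.cong refl, subst sum.swap) (rule refl)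
  finally have K: "kloosterman_form k q \<alpha> J = (\<Sum>\<sigma>\<in>{1, -1}. \<Sum>i\<in>I. T \<sigma> i)" .
  have T: "cmod (T \<sigma> i) \<le> R" if \<sigma>: "\<sigma> \<in> {1, -1}" for \<sigma> i
  proof (cases "H \<sigma> i = {}")
    case True
    then show ?thesis using R0 by (simp add: T_def)
  next
    case False
    then obtain y0 where y0: "y0 \<in> half_units q \<sigma>" "floor_log (nat y0) = i" by (auto simp: H_def)
    \<comment> \<open>A nonempty block contains some y with 2^i \<le> y \<le> q/2. Hence the upper
      end 2^(i+1) of the range, which bounds the variables, is still a scale covered by
      \<open>sol\<close>; empty blocks contribute 0.\<close>
    have q2: "2 ^ (i + 1) \<le> q" using unit[OF y0(1)] fl[of y0] y0(2) by simp
    \<comment> \<open>The bound for the geometric sum at the lower end of the range, where it is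
      weakest. With X = 2^(i+1) it satisfies both inequalities required by
      \<open>block_weight_le\<close>.\<close>
    define G where "G = min (real N) (of_int q / 2 ^ i)"
    have g: "cmod (\<gamma> \<sigma> y) \<le> G" if y: "y \<in> H \<sigma> i" for y
    proof -
      have yu: "y \<in> half_units q \<sigma>" "floor_log (nat y) = i" using y by (auto simp: H_def)
      have "cmod (\<gamma> \<sigma> y) \<le> min (real N) (of_int q / of_int y)"
      proof -
        have "\<gamma> \<sigma> y = (\<Sum>j\<in>{L + 1..L + int N}. unit_char q (j * (\<sigma> * y)))"
          unfolding \<gamma>_def interval_char_sum_def J_def using N q by (intro sum_residue_interval) auto
        moreover have "0 < y" "2 * y \<le> q" using unit[OF yu(1)] by auto
        ultimately show ?thesis using norm_sum_unit_char_interval_le[of y q \<sigma> L N] \<sigma> by simp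
      qed
      also have "\<dots> \<le> G"
      proof -
        have "2 ^ i \<le> y" using unit[OF yu(1)] fl[of y] yu(2) by simp
        then have "real_of_int (2 ^ i) \<le> of_int y" by (simp only: of_int_le_iff)
        then have "real_of_int q / of_int y \<le> of_int q / 2 ^ i"
          using q unit[OF yu(1)] by (intro divide_left_mono mult_pos_pos) auto
        then show ?thesis unfolding G_def by (intro min.mono) auto
      qed
      finally show ?thesis .
    qed
    have "cmod (T \<sigma> i) \<le> weights_norm1 q \<alpha> powr (1 - 1 / real \<nu>) * weights_norm2 q \<alpha> powr (1 / real \<nu>)
      * (of_int q * G ^ (2 * \<nu>) * real (card (inverse_solutions k \<nu> q (2 ^ (i + 1))))) powr (1 / (2 * real \<nu>))"
      unfolding T_def
    proof (rule block_sum_le)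
      show "\<sigma> * \<sigma> = 1" using \<sigma> by auto
      fix y assume y: "y \<in> H \<sigma> i"
      then show "1 \<le> y \<and> y \<le> int (2 ^ (i + 1)) \<and> coprime y q"
        using unit[of y \<sigma>] fl[of y] by (auto simp: H_def)
    qed (use q nu g in auto)
    also have "\<dots> \<le> R"
      unfolding R_def
    proof (intro mult_left_mono block_weight_le[where X = "2 ^ (i + 1)"])
      have G1: "G \<le> real N" "G \<le> of_int q / 2 ^ i" by (simp_all add: G_def)
      show G0: "G \<ge> 0" using q by (simp add: G_def)
      show GX: "G * 2 ^ (i + 1) \<le> 2 * of_int q"
        using G1(2) by (simp add: field_simps)
      have "G\<^sup>2 * 2 ^ (i + 1) = G * (G * 2 ^ (i + 1))" by (simp add: power2_eq_square)
      also have "\<dots> \<le> real N * (2 * of_int q)"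
        by (rule mult_mono[OF G1(1) GX]) (use G0 in auto)
      finally show "G\<^sup>2 * 2 ^ (i + 1) \<le> 2 * real N * of_int q" by (simp add: mult_ac)
      show "real (card (inverse_solutions k \<nu> q (2 ^ (i + 1))))
          \<le> ((2 ^ (i + 1)) ^ \<nu> + 2 * (2 ^ (i + 1)) ^ (2 * \<nu>) / of_int q) * E"
        by (rule sol[OF q2])
    qed (use q nu E in auto)
    finally show ?thesis .
  qed
  have "cmod (kloosterman_form k q \<alpha> J) \<le> (\<Sum>\<sigma>\<in>{1, -1::int}. \<Sum>i\<in>I. R)"
    unfolding K using T by (intro sum_norm_le) auto
  also have "\<dots> = 2 * real (card I) * R" by simp
  finally show ?thesis unfolding J_def I_def R_def .
qed

theorem theorem2p4:
  fixes k \<nu> :: nat and \<epsilon> :: real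
  assumes "k > 1" and "\<nu> > 0" and "\<epsilon> > 0"
  shows "\<exists>c>0. \<exists>C>0. \<exists>Q\<^sub>0\<ge>1. \<forall>Q::real. Q \<ge> Q\<^sub>0 \<longrightarrow>
    real (card {q::int. Q \<le> real_of_int q \<and> real_of_int q \<le> 2 * Q \<and>
      \<not> (\<forall>(\<alpha> :: int \<Rightarrow> complex) (L :: int) (N :: nat). int N \<le> q \<longrightarrow>
          cmod (kloosterman_form k q \<alpha> (residue_interval q L N))
            \<le> c * (weights_norm1 q \<alpha> powr (1 - 1 / real \<nu>) * weights_norm2 q \<alpha> powr (1 / real \<nu>)
                 * (real_of_int q
                    + real_of_int q powr ((real \<nu> + 1) / (2 * real \<nu>)) * real N powr (1 / 2))
                 * real_of_int q powr \<epsilon>))})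
      \<le> C * Q powr (1 - \<epsilon>)"
proof (rule card_exceptional_moduli[of k \<epsilon> \<nu>])
  show "k > 0" "\<epsilon> > 0" using assms by auto
  have e: "\<epsilon> / 4 > 0" using assms by simp
  fix C :: real
  assume C: "C > 0"
    "\<And>Q. Q \<ge> 1 \<Longrightarrow>
      real (card {q::int. Q \<le> real_of_int q \<and> real_of_int q \<le> 2 * Q \<and>
        (\<exists>i. 2 ^ i \<le> 4 * Q \<and> real (card (inverse_solutions k \<nu> q (2 ^ i)))
           > ((2 ^ i) ^ \<nu> + (2 ^ i) ^ (2 * \<nu>) / Q) * Q powr (3 * \<epsilon> / 2))})
      \<le> C * Q powr (1 - \<epsilon>)"
  obtain K where K: "K \<ge> 1" "\<And>x::real. x \<ge> 1 \<Longrightarrow> finite {i::nat. 2 ^ i \<le> x}"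
    "\<And>x::real. x \<ge> 1 \<Longrightarrow> real (card {i::nat. 2 ^ i \<le> x}) \<le> K * x powr (\<epsilon> / 4)"
    using card_powers_of_2_le[OF e] by blast
  \<comment> \<open>Goodness of a modulus concerns solution counts only, so one exceptional set
    serves all weights and all intervals. The constant \<open>8 * K\<close> combines 2 signs, the 4
    of \<open>block_weight_le\<close>, and \<open>K\<close> from the number of scales.\<close>
  have bound: "cmod (kloosterman_form k q \<alpha> (residue_interval q L N))
            \<le> 8 * K * (weights_norm1 q \<alpha> powr (1 - 1 / real \<nu>) * weights_norm2 q \<alpha> powr (1 / real \<nu>)
                 * (real_of_int q + real_of_int q powr ((real \<nu> + 1) / (2 * real \<nu>)) * real N powr (1 / 2))
                 * real_of_int q powr \<epsilon>)"
    if Q: "Q \<ge> 2" "Q \<le> real_of_int q" "real_of_int q \<le> 2 * Q" and N: "int N \<le> q"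
      and good: "\<And>i. 2 ^ i \<le> 4 * Q \<Longrightarrow> real (card (inverse_solutions k \<nu> q (2 ^ i)))
           \<le> ((2 ^ i) ^ \<nu> + (2 ^ i) ^ (2 * \<nu>) / Q) * Q powr (3 * \<epsilon> / 2)"
    for Q :: real and q :: int and \<alpha> L N
  proof -
    define E where "E = real_of_int q powr (3 * \<epsilon> / 2)"
    define A where "A = weights_norm1 q \<alpha> powr (1 - 1 / real \<nu>) * weights_norm2 q \<alpha> powr (1 / real \<nu>)"
    define V where "V = real_of_int q + real_of_int q powr ((real \<nu> + 1) / (2 * real \<nu>)) * real N powr (1 / 2)"
    have q1: "real_of_int q \<ge> 2" "q > 1" using Q by linarith+
    have A0: "A \<ge> 0" by (simp add: A_def)
    have V0: "V \<ge> 0" using q1 by (simp add: V_def)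
    have "cmod (kloosterman_form k q \<alpha> (residue_interval q L N))
      \<le> 2 * real (card {i::nat. 2 ^ i \<le> real_of_int q}) * (A * (4 * V * E powr (1 / (2 * real \<nu>))))"
      unfolding A_def V_def
    proof (rule kloosterman_form_le[OF q1(2) assms(2) N])
      show "E \<ge> 0" by (simp add: E_def)
      fix i :: nat assume "2 ^ i \<le> q"
      then have "real_of_int (2 ^ i) \<le> real_of_int q" by (simp only: of_int_le_iff)
      then have "2 ^ i \<le> real_of_int q" by (simp only: of_int_power of_int_numeral)
      then have "2 ^ i \<le> 4 * Q" using Q by linarith
      then have "real (card (inverse_solutions k \<nu> q (2 ^ i)))
           \<le> ((2 ^ i) ^ \<nu> + (2 ^ i) ^ (2 * \<nu>) / Q) * Q powr (3 * \<epsilon> / 2)" by (rule good)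
      also have "\<dots> \<le> ((2 ^ i) ^ \<nu> + 2 * (2 ^ i) ^ (2 * \<nu>) / of_int q) * E"
      proof (intro mult_mono add_mono order_refl)
        \<comment> \<open>Here \<open>q \<le> 2 * Q\<close> replaces \<open>Q\<close> by the modulus
          itself, the source of the factor 2 in the hypothesis on solution counts.\<close>
        have "1 / Q \<le> 2 / real_of_int q" using Q q1 by (simp add: field_simps)
        then have "(2 ^ i) ^ (2 * \<nu>) * (1 / Q) \<le> (2 ^ i) ^ (2 * \<nu>) * (2 / real_of_int q)"
          by (intro mult_left_mono) auto
        then show "(2 ^ i) ^ (2 * \<nu>) / Q \<le> 2 * (2 ^ i) ^ (2 * \<nu>) / real_of_int q"
          by (simp add: mult.commute)
        show "Q powr (3 * \<epsilon> / 2) \<le> E"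
          unfolding E_def using Q assms by (intro powr_mono2) auto
      qed (use q1 in auto)
      finally show "real (card (inverse_solutions k \<nu> q (2 ^ i)))
          \<le> ((2 ^ i) ^ \<nu> + 2 * (2 ^ i) ^ (2 * \<nu>) / of_int q) * E" .
    qed
    \<comment> \<open>Of the exponent \<epsilon>, one quarter pays for the scales and the rest for
      the root of \<open>E\<close>, which is the power 3\<epsilon>/(4\<nu>) of \<open>q\<close> and
      \<nu> \<ge> 1.\<close>
    also have "\<dots> \<le> 2 * (K * real_of_int q powr (\<epsilon> / 4)) * (A * (4 * V * real_of_int q powr (3 * \<epsilon> / 4)))"
    proof (intro mult_mono mult_left_mono)
      show "real (card {i::nat. 2 ^ i \<le> real_of_int q}) \<le> K * real_of_int q powr (\<epsilon> / 4)"
        using K(3)[of "real_of_int q"] q1 by simp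
      have "E powr (1 / (2 * real \<nu>)) = real_of_int q powr (3 * \<epsilon> / 4 / real \<nu>)"
        by (simp add: E_def powr_powr)
      also have "\<dots> \<le> real_of_int q powr (3 * \<epsilon> / 4)"
      proof (intro powr_mono)
        have "3 * \<epsilon> / 4 / real \<nu> \<le> 3 * \<epsilon> / 4 / 1"
          using assms by (intro divide_left_mono) auto
        then show "3 * \<epsilon> / 4 / real \<nu> \<le> 3 * \<epsilon> / 4" by simp
      qed (use q1 in auto)
      finally show "E powr (1 / (2 * real \<nu>)) \<le> real_of_int q powr (3 * \<epsilon> / 4)" .
    qed (use A0 V0 K q1 in auto)
    also have "\<dots> = 8 * K * (A * V * (real_of_int q powr (\<epsilon> / 4) * real_of_int q powr (3 * \<epsilon> / 4)))"
      by simp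
    also have "real_of_int q powr (\<epsilon> / 4) * real_of_int q powr (3 * \<epsilon> / 4) = real_of_int q powr \<epsilon>"
      by (simp add: powr_add[symmetric])
    finally show ?thesis unfolding A_def V_def .
  qed
  show ?thesis
  \<comment> \<open>The threshold 2 for \<open>Q\<close> guarantees \<open>q > 1\<close>, as the
    bound for a single modulus demands.\<close>
  proof (rule exI[of _ "8 * K"], rule conjI, use K(1) in linarith,
      rule exI[of _ C], rule conjI, rule C(1), rule exI[of _ "2::real"], intro conjI allI impI)
    fix Q :: real assume Q: "2 \<le> Q"
    have "card {q::int. Q \<le> real_of_int q \<and> real_of_int q \<le> 2 * Q \<and>
      \<not> (\<forall>(\<alpha> :: int \<Rightarrow> complex) (L :: int) (N :: nat). int N \<le> q \<longrightarrow>
          cmod (kloosterman_form k q \<alpha> (residue_interval q L N))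
            \<le> 8 * K * (weights_norm1 q \<alpha> powr (1 - 1 / real \<nu>) * weights_norm2 q \<alpha> powr (1 / real \<nu>)
                 * (real_of_int q
                    + real_of_int q powr ((real \<nu> + 1) / (2 * real \<nu>)) * real N powr (1 / 2))
                 * real_of_int q powr \<epsilon>))}
      \<le> card {q::int. Q \<le> real_of_int q \<and> real_of_int q \<le> 2 * Q \<and>
        (\<exists>i. 2 ^ i \<le> 4 * Q \<and> real (card (inverse_solutions k \<nu> q (2 ^ i)))
           > ((2 ^ i) ^ \<nu> + (2 ^ i) ^ (2 * \<nu>) / Q) * Q powr (3 * \<epsilon> / 2))}"
      (is "card ?S \<le> card ?T")
    proof (rule card_mono)
      show "finite ?T"
        by (rule finite_subset[OF _ card_integers_between_le(1)[of Q]]) (use Q in auto)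
      show "?S \<subseteq> ?T"
      proof
        fix q assume q: "q \<in> ?S"
        show "q \<in> ?T"
        proof (rule ccontr)
          assume "q \<notin> ?T"
          with q have "real (card (inverse_solutions k \<nu> q (2 ^ i)))
              \<le> ((2 ^ i) ^ \<nu> + (2 ^ i) ^ (2 * \<nu>) / Q) * Q powr (3 * \<epsilon> / 2)" if "2 ^ i \<le> 4 * Q" for i
            using that by (simp add: not_less)
          with q Q bound[of Q q] show False by blast
        qed
      qed
    qed
    then have "real (card ?S) \<le> real (card ?T)" by (rule of_nat_mono)
    also have "\<dots> \<le> C * Q powr (1 - \<epsilon>)" using C(2)[of Q] Q by simp
    finally show "real (card ?S) \<le> C * Q powr (1 - \<epsilon>)" .
  qed simp
qed

end
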